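(* Let $c>0$ be a finite constant and let $(X'_i)_{i\ge1}$ be independent (not necessarily identically distributed) absolutely continuous random variables with $X'_i\ge -c$, whose PDFs $f'_i$ (not to be confused with derivatives) are continuous on $[-c,\infty)$ and zero on $(-\infty,-c)$. For $n\ge 1$ let $Y'_n=\sum_{i=1}^n X'_i$ and $Z'_n=\max_{1\le i\le n}X'_i$. Put $f_i(x)=f'_i(x-c)$ and $F_i(x)=\int_0^x f_i(t)\,dt$ for $x\ge 0$. Define $G_n$ on $\mathbb{R}_+^2=[0,\infty)^2$ by $G_1(y,z)=F_1(\min(y,z))$ and, for $n\ge 2$, $G_n(y,z)=\int_0^{\min(y,z)}G_{n-1}(y-x,z)f_n(x)\,dx$ (with $G_n=0$ outside $\mathbb{R}_+^2$). Define $g_n$ on $\mathcal D_n=\{(y,z)\in\mathbb{R}_+^2: z\le y\le nz\}$ by $g_1(y,z)=f_1(z)\,\delta(y-z)$ ($\delta$ the Dirac delta) and, for $n\ge2$, $g_n(y,z)=f_n(z)\int_0^z g_{n-1}(y-z,x)\,dx+\int_0^z f_n(x)g_{n-1}(y-x,z)\,dx$ (with $g_n=0$ outside $\mathcal D_n$). Then, for every $n\ge 1$, the joint CDF of $(Y'_n,Z'_n)$ is $$G'_n(y,z):=P(Y'_n\le y,\ Z'_n\le z)=G_n(y+nc,\ z+c),$$ and the joint PDF of $(Y'_n,Z'_n)$ is $$g'_n(y,z)=\frac{\partial^2}{\partial y\,\partial z}G'_n(y,z)=g_n(y+nc,\ z+c).$$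
   Context: Joint PDFs are understood up to equality almost everywhere, i.e. $g'_n$ is a (generalized, if $n=1$) density whose integral over $(-\infty,y]\times(-\infty,z]$ is $G'_n(y,z)$. Dirac delta convention: $\delta(x)\ge 0$, $\delta(-x)=\delta(x)$, and for $a\le b$, $\int_a^b f(t)\,\delta(t-s)\,dt=f(s)$ if $a\le s\le b$ and $0$ otherwise. Endpoints count with full mass, including the case $a=b=s$. Thus $\int_0^z g_1(u,x)\,dx=f_1(u)$ if $0\le u\le z$ and $0$ otherwise, and $\int_0^z f_2(x)\,g_1(y-x,z)\,dx=f_2(y-z)f_1(z)$ if $0\le y-z\le z$ and $0$ otherwise. *)

theory Defs
  imports "HOL-Probability.Probability"
begin

text \<open>The integral of \<open>\<phi>(t) \<delta>(t - s) dt\<close> over \<open>A\<close>; a point of \<open>A\<close> counts with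
  full mass even if it is an endpoint.\<close>

definition delta_integral :: "real set \<Rightarrow> (real \<Rightarrow> real) \<Rightarrow> real \<Rightarrow> real" where
  "delta_integral A \<phi> s = (if s \<in> A then \<phi> s else 0)"

text \<open>\<open>GenFun r h d\<close> stands for the generalized function
  \<open>r(y,z) + h(y,z) \<delta>(y - z - d)\<close> of two real variables.\<close>

datatype gen_fun =
  GenFun (reg_part: "real \<Rightarrow> real \<Rightarrow> real") (delta_coeff: "real \<Rightarrow> real \<Rightarrow> real")
    (delta_offset: real)

text \<open>\<open>g(y + a, z + b)\<close> as a generalized function of \<open>(y,z)\<close>; its delta factor is
  \<open>\<delta>((y + a) - (z + b) - d) = \<delta>(y - z - (d + b - a))\<close>.\<close>

definition gen_shift :: "real \<Rightarrow> real \<Rightarrow> gen_fun \<Rightarrow> gen_fun" where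
  "gen_shift a b g =
     GenFun (\<lambda>y z. reg_part g (y + a) (z + b)) (\<lambda>y z. delta_coeff g (y + a) (z + b))
       (delta_offset g + b - a)"

text \<open>The integral of \<open>g(u,x) dx\<close> over \<open>A\<close>. The delta factor is
  \<open>\<delta>(u - x - d) = \<delta>(x - (u - d))\<close>.\<close>

definition snd_integral :: "gen_fun \<Rightarrow> real set \<Rightarrow> real \<Rightarrow> real" where
  "snd_integral g A u =
     (LINT x:A|lborel. reg_part g u x)
     + delta_integral A (\<lambda>x. delta_coeff g u x) (u - delta_offset g)"

text \<open>The integral of \<open>\<phi>(x) g(y - x, z) dx\<close> over \<open>A\<close>. The delta factor is
  \<open>\<delta>(y - x - z - d) = \<delta>(x - (y - z - d))\<close>.\<close>

definition conv_integral :: "(real \<Rightarrow> real) \<Rightarrow> gen_fun \<Rightarrow> real set \<Rightarrow> real \<Rightarrow> real \<Rightarrow> real" where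
  "conv_integral \<phi> g A y z =
     (LINT x:A|lborel. \<phi> x * reg_part g (y - x) z)
     + delta_integral A (\<lambda>x. \<phi> x * delta_coeff g (y - x) z) (y - z - delta_offset g)"

text \<open>The integral of \<open>g(u,v) du dv\<close> over \<open>(-\<infinity>,y] \<times> (-\<infinity>,z]\<close>, for \<open>g\<close> with nonnegative
  parts. The delta part is integrated in \<open>u\<close> first, where its mass sits at \<open>u = v + d\<close>.\<close>

definition quadrant_integral :: "gen_fun \<Rightarrow> real \<Rightarrow> real \<Rightarrow> ennreal" where
  "quadrant_integral g y z =
     (\<integral>\<^sup>+p\<in>{..y} \<times> {..z}. ennreal (reg_part g (fst p) (snd p)) \<partial>(lborel \<Otimes>\<^sub>M lborel))
     + (\<integral>\<^sup>+v\<in>{..z}. ennreal (delta_integral {..y} (\<lambda>u. delta_coeff g u v) (v + delta_offset g)) \<partial>lborel)"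

definition generalized_joint_pdf ::
    "'a measure \<Rightarrow> ('a \<Rightarrow> real) \<Rightarrow> ('a \<Rightarrow> real) \<Rightarrow> gen_fun \<Rightarrow> bool" where
  "generalized_joint_pdf M Y Z g \<longleftrightarrow>
     (\<lambda>(y, z). reg_part g y z) \<in> borel_measurable (lborel \<Otimes>\<^sub>M lborel) \<and>
     (\<lambda>(y, z). delta_coeff g y z) \<in> borel_measurable (lborel \<Otimes>\<^sub>M lborel) \<and>
     (\<forall>y z. 0 \<le> reg_part g y z \<and> 0 \<le> delta_coeff g y z) \<and>
     (\<forall>y z. quadrant_integral g y z
              = ennreal (measure M {\<omega> \<in> space M. Y \<omega> \<le> y \<and> Z \<omega> \<le> z}))"

text \<open>\<open>\<partial>/\<partial>y (\<partial>/\<partial>z G) = D\<close> at \<open>(y,z)\<close>.\<close>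

definition has_mixed_partial :: "(real \<Rightarrow> real \<Rightarrow> real) \<Rightarrow> real \<Rightarrow> real \<Rightarrow> real \<Rightarrow> bool" where
  "has_mixed_partial G D y z \<longleftrightarrow>
     (\<exists>H. (\<forall>\<^sub>F u in nhds y. ((\<lambda>v. G u v) has_real_derivative H u) (at z)) \<and>
          (H has_real_derivative D) (at y))"

definition partial_sum :: "(nat \<Rightarrow> 'a \<Rightarrow> real) \<Rightarrow> nat \<Rightarrow> 'a \<Rightarrow> real" where
  "partial_sum X n \<omega> = (\<Sum>i=1..n. X i \<omega>)"

definition partial_max :: "(nat \<Rightarrow> 'a \<Rightarrow> real) \<Rightarrow> nat \<Rightarrow> 'a \<Rightarrow> real" where
  "partial_max X n \<omega> = Max ((\<lambda>i. X i \<omega>) ` {1..n})"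

definition joint_cdf :: "'a measure \<Rightarrow> (nat \<Rightarrow> 'a \<Rightarrow> real) \<Rightarrow> nat \<Rightarrow> real \<Rightarrow> real \<Rightarrow> real" where
  "joint_cdf M X n y z =
     measure M {\<omega> \<in> space M. partial_sum X n \<omega> \<le> y \<and> partial_max X n \<omega> \<le> z}"

definition shifted_pdf :: "real \<Rightarrow> (nat \<Rightarrow> real \<Rightarrow> real) \<Rightarrow> nat \<Rightarrow> real \<Rightarrow> real" where
  "shifted_pdf c f' i x = f' i (x - c)"

definition F_fun :: "(nat \<Rightarrow> real \<Rightarrow> real) \<Rightarrow> nat \<Rightarrow> real \<Rightarrow> real" where
  "F_fun f i x = (LINT t:{0..x}|lborel. f i t)"

text \<open>The index \<open>0\<close> is a dummy value in the two recursions below.\<close>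

fun G_fun :: "(nat \<Rightarrow> real \<Rightarrow> real) \<Rightarrow> nat \<Rightarrow> real \<Rightarrow> real \<Rightarrow> real" where
  "G_fun f 0 y z = 0"
| "G_fun f (Suc 0) y z = (if 0 \<le> y \<and> 0 \<le> z then F_fun f 1 (min y z) else 0)"
| "G_fun f (Suc (Suc n)) y z =
     (if 0 \<le> y \<and> 0 \<le> z
      then (LINT x:{0..min y z}|lborel. G_fun f (Suc n) (y - x) z * f (Suc (Suc n)) x)
      else 0)"

definition D_set :: "nat \<Rightarrow> (real \<times> real) set" where
  "D_set n = {(y, z). 0 \<le> y \<and> 0 \<le> z \<and> z \<le> y \<and> y \<le> real n * z}"

fun g_fun :: "(nat \<Rightarrow> real \<Rightarrow> real) \<Rightarrow> nat \<Rightarrow> gen_fun" where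
  "g_fun f 0 = GenFun (\<lambda>y z. 0) (\<lambda>y z. 0) 0"
| "g_fun f (Suc 0) = GenFun (\<lambda>y z. 0) (\<lambda>y z. if (y, z) \<in> D_set 1 then f 1 z else 0) 0"
| "g_fun f (Suc (Suc n)) =
     GenFun
       (\<lambda>y z. if (y, z) \<in> D_set (Suc (Suc n))
         then f (Suc (Suc n)) z * snd_integral (g_fun f (Suc n)) {0..z} (y - z)
              + conv_integral (f (Suc (Suc n))) (g_fun f (Suc n)) {0..z} y z
         else 0)
       (\<lambda>y z. 0) 0"

lemma snd_integral_g1:
  "snd_integral (g_fun f 1) {0..z} u = (if 0 \<le> u \<and> u \<le> z then f 1 u else 0)"
  by (auto simp: snd_integral_def delta_integral_def D_set_def)

lemma conv_integral_g1:
  "conv_integral (f 2) (g_fun f 1) {0..z} y z =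
     (if 0 \<le> y - z \<and> y - z \<le> z then f 2 (y - z) * f 1 z else 0)"
  by (auto simp: conv_integral_def delta_integral_def D_set_def)

end

theory Submission imports Defs begin

text \<open>
  After the shift \<open>U i = X i + c \<ge> 0\<close>, let \<open>S\<close> and \<open>W\<close> be the sum and the maximum of the first
  \<open>n\<close> variables. Conditioning on \<open>U (Suc n) = x\<close> turns \<open>(S, W)\<close> into \<open>(S + x, max W x)\<close>. For
  the distribution function this is the recursion of \<open>G_fun\<close>. For the density, splitting at
  \<open>W = x\<close> gives its two terms: if \<open>W < x\<close> the new maximum is \<open>x\<close> and \<open>W\<close> is integrated out;
  if \<open>W > x\<close> the maximum stays and \<open>x\<close> is integrated out.

  For \<open>n \<ge> 2\<close> the density is bounded on \<open>z \<le> R\<close> and continuous off the two boundary lines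
  \<open>y = z\<close> and \<open>y = n z\<close> of its support. Each horizontal line meets these in at most two points,
  so by dominated convergence the inner integral of the density over \<open>s \<le> u\<close> is continuous in
  the second variable, and the fundamental theorem of calculus, applied in \<open>z\<close> and then in
  \<open>y\<close>, yields the mixed partial derivative off the two lines.
\<close>


section \<open>Densities supported in \<open>D_set n\<close>\<close>

lemma closed_D_set: "closed (D_set n)"
proof -
  have "D_set n = {p. 0 \<le> fst p} \<inter> {p. 0 \<le> snd p} \<inter> {p. snd p \<le> fst p}
      \<inter> {p. fst p \<le> real n * snd p}"
    by (auto simp: D_set_def)
  then show ?thesis
    by (auto intro!: closed_Int closed_Collect_le continuous_intros)
qed

lemma isCont_zero_off_closed:
  fixes h :: "'b::t2_space \<Rightarrow> real"
  assumes "closed D" "p \<notin> D" "\<And>q. q \<notin> D \<Longrightarrow> h q = 0"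
  shows "isCont h p"
proof -
  have "\<forall>\<^sub>F q in nhds p. q \<in> - D"
    using assms by (intro eventually_nhds_in_open) auto
  then have "\<forall>\<^sub>F q in nhds p. h q = 0" by eventually_elim (use assms in auto)
  from isCont_cong[OF this] show ?thesis by simp
qed

text \<open>The definitions use the Bochner integral, which is 0 for a nonintegrable function, while
  the probabilistic arguments use \<open>nn_integral\<close>. Nonnegative bounded integrands on
  compact intervals are where the two agree. The final estimate carries local boundedness through
  the recursion.\<close>

lemma set_integral_nonneg_bounded:
  fixes h :: "real \<Rightarrow> real"
  assumes "h \<in> borel_measurable borel" and "\<And>x. x \<in> {a..b} \<Longrightarrow> 0 \<le> h x \<and> h x \<le> K"
  shows "set_integrable lborel {a..b} h"
    and "ennreal (LINT x:{a..b}|lborel. h x) = (\<integral>\<^sup>+x\<in>{a..b}. ennreal (h x) \<partial>lborel)"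
    and "0 \<le> (LINT x:{a..b}|lborel. h x)"
    and "a \<le> b \<Longrightarrow> (LINT x:{a..b}|lborel. h x) \<le> K * (b - a)"
proof -
  show int: "set_integrable lborel {a..b} h"
    unfolding set_integrable_def
    by (rule integrableI_bounded_set_indicator[where B=K])
       (use assms in \<open>auto simp: abs_of_nonneg emeasure_lborel_Icc_eq\<close>)
  have "ennreal (LINT x:{a..b}|lborel. h x)
      = (\<integral>\<^sup>+x. ennreal (indicator {a..b} x *\<^sub>R h x) \<partial>lborel)"
    unfolding set_lebesgue_integral_def
    by (rule nn_integral_eq_integral[symmetric])
       (use int assms in \<open>auto simp: set_integrable_def indicator_def\<close>)
  also have "\<dots> = (\<integral>\<^sup>+x\<in>{a..b}. ennreal (h x) \<partial>lborel)"
    by (intro nn_integral_cong) (auto simp: indicator_def)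
  finally show "ennreal (LINT x:{a..b}|lborel. h x)
      = (\<integral>\<^sup>+x\<in>{a..b}. ennreal (h x) \<partial>lborel)" .
  show "0 \<le> (LINT x:{a..b}|lborel. h x)"
    unfolding set_lebesgue_integral_def
    by (rule integral_nonneg_AE) (use assms in \<open>auto simp: indicator_def\<close>)
  assume "a \<le> b"
  have "(LINT x:{a..b}|lborel. h x) \<le> (LINT x:{a..b}|lborel. K)"
    by (rule set_integral_mono[OF int])
       (use assms \<open>a \<le> b\<close> in \<open>auto simp: set_integrable_def\<close>)
  also have "\<dots> = K * (b - a)"
    using \<open>a \<le> b\<close> by (simp add: set_lebesgue_integral_def)
  finally show "(LINT x:{a..b}|lborel. h x) \<le> K * (b - a)" .
qed

text \<open>Moves the limits of integration into the integrand, so that measurability in the limits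
  and dominated convergence with moving limits concern integrals over the whole line.\<close>

lemma set_integral_eq_if:
  "(LINT x:{a..b}|lborel. h x) = (LINT x|lborel. (if a \<le> x \<and> x \<le> b then h x else (0::real)))"
  for a b :: real
  unfolding set_lebesgue_integral_def by (intro Bochner_Integration.integral_cong) auto

text \<open>The invariant that the density recursion preserves from \<open>n = 2\<close> on. The
  bound is local because the PDFs may be unbounded at infinity; restricting \<open>z\<close>
  suffices, since \<open>y\<close> is at most \<open>real n * z\<close> on the support. Jumps on the
  two excluded lines can occur for \<open>n = 2\<close>, where a formula is cut off at the boundary
  of \<open>D_set 2\<close>.\<close>

definition tame :: "nat \<Rightarrow> (real \<Rightarrow> real \<Rightarrow> real) \<Rightarrow> bool" where
  "tame n r \<longleftrightarrow>
     (\<lambda>(y, z). r y z) \<in> borel_measurable (borel \<Otimes>\<^sub>M borel) \<and>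
     (\<forall>y z. 0 \<le> r y z) \<and>
     (\<forall>R. \<exists>K. \<forall>y z. z \<le> R \<longrightarrow> r y z \<le> K) \<and>
     (\<forall>y z. (y, z) \<notin> D_set n \<longrightarrow> r y z = 0) \<and>
     (\<forall>y z. y \<noteq> z \<longrightarrow> y \<noteq> real n * z \<longrightarrow> isCont (\<lambda>(y, z). r y z) (y, z))"

lemma tameD:
  assumes "tame n r"
  shows "(\<lambda>(y, z). r y z) \<in> borel_measurable (borel \<Otimes>\<^sub>M borel)"
    and "0 \<le> r y z"
    and "\<exists>K\<ge>0. \<forall>y z. z \<le> R \<longrightarrow> r y z \<le> K"
    and "(y, z) \<notin> D_set n \<Longrightarrow> r y z = 0"
    and "y \<noteq> z \<Longrightarrow> y \<noteq> real n * z \<Longrightarrow> isCont (\<lambda>(y, z). r y z) (y, z)"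
proof -
  obtain K where "\<forall>y z. z \<le> R \<longrightarrow> r y z \<le> K"
    using assms unfolding tame_def by blast
  then have "\<forall>y z. z \<le> R \<longrightarrow> r y z \<le> max 0 K"
    by (auto simp: le_max_iff_disj)
  then show "\<exists>K\<ge>0. \<forall>y z. z \<le> R \<longrightarrow> r y z \<le> K"
    by (intro exI[of _ "max 0 K"]) auto
qed (use assms in \<open>auto simp: tame_def\<close>)

lemma tame_measurable:
  assumes "tame n r" "u \<in> borel_measurable N" "v \<in> borel_measurable N"
  shows "(\<lambda>x. r (u x) (v x)) \<in> borel_measurable N"
proof -
  have "(\<lambda>x. (u x, v x)) \<in> measurable N (borel \<Otimes>\<^sub>M borel)"
    using assms by measurable
  from measurable_compose[OF this tameD(1)[OF assms(1)]] show ?thesis by simp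
qed

lemma tame_tendsto:
  assumes "tame n r" "y \<noteq> z" "y \<noteq> real n * z" "(u \<longlongrightarrow> y) F" "(v \<longlongrightarrow> z) F"
  shows "((\<lambda>k. r (u k) (v k)) \<longlongrightarrow> r y z) F"
  using isCont_tendsto_compose[OF tameD(5)[OF assms(1-3)] tendsto_Pair[OF assms(4,5)]]
  by simp

text \<open>Serves integrands that are cut off at a moving endpoint: at almost every point the
  cutoff condition eventually settles.\<close>

lemma tendsto_if_eventually_const:
  assumes "\<forall>\<^sub>F k in F. P k = Q" "(h \<longlongrightarrow> l) F"
  shows "((\<lambda>k. if P k then h k else 0) \<longlongrightarrow> (if Q then l else 0)) F"
proof -
  have "\<forall>\<^sub>F k in F. (if P k then h k else 0) = (if Q then h k else 0)"
    using assms(1) by eventually_elim simp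
  then show ?thesis
    using assms(2) by (subst tendsto_cong) auto
qed

section \<open>The recursion for the density\<close>

locale nonneg_density =
  fixes \<phi> :: "real \<Rightarrow> real"
  assumes nonneg: "0 \<le> \<phi> x" and cont: "continuous_on {0..} \<phi>" and neg: "x < 0 \<Longrightarrow> \<phi> x = 0"
begin

lemma measurable: "\<phi> \<in> borel_measurable borel"
proof -
  have "(\<lambda>x. indicator {0..} x *\<^sub>R \<phi> x) \<in> borel_measurable borel"
    by (rule borel_measurable_continuous_on_indicator) (use cont in auto)
  also have "(\<lambda>x. indicator {0..} x *\<^sub>R \<phi> x) = \<phi>"
    using neg by (auto simp: indicator_def not_le fun_eq_iff)
  finally show ?thesis .
qed

lemma isCont_pos: "x > 0 \<Longrightarrow> isCont \<phi> x"
  using continuous_on_interior[OF cont] by (auto simp: interior_real_atLeast)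

text \<open>Compactness gives the bound on \<open>{0..R}\<close>; to the left of 0 the function
  vanishes.\<close>

lemma locally_bounded: "\<exists>B\<ge>0. \<forall>x\<le>R. \<phi> x \<le> B"
proof -
  have "compact (\<phi> ` {0..R})"
    by (rule compact_continuous_image[OF continuous_on_subset[OF cont]]) auto
  then obtain B where B: "\<forall>t\<in>\<phi> ` {0..R}. norm t \<le> B"
    using compact_imp_bounded bounded_iff by metis
  have "\<phi> x \<le> max 0 B" if "x \<le> R" for x
  proof (cases "x < 0")
    case False
    then have "norm (\<phi> x) \<le> B" using B that by auto
    then show ?thesis by auto
  qed (simp add: neg)
  then show ?thesis by (intro exI[of _ "max 0 B"]) auto
qed

text \<open>The recursion of \<open>g_fun\<close> for a predecessor without delta part, and without
  the cutoff to \<open>D_set\<close>. By \<open>step_eq_0\<close> the cutoff is automatic.\<close>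

definition step :: "(real \<Rightarrow> real \<Rightarrow> real) \<Rightarrow> real \<Rightarrow> real \<Rightarrow> real" where
  "step r y z = \<phi> z * (LINT x:{0..z}|lborel. r (y - z) x) + (LINT x:{0..z}|lborel. \<phi> x * r (y - x) z)"

lemma snd_slice:
  assumes "tame n r"
  shows "ennreal (LINT x:{0..z}|lborel. r u x) = (\<integral>\<^sup>+x\<in>{0..z}. ennreal (r u x) \<partial>lborel)"
    and "0 \<le> (LINT x:{0..z}|lborel. r u x)"
proof -
  obtain K where K: "\<forall>y x. x \<le> z \<longrightarrow> r y x \<le> K"
    using tameD(3)[OF assms] by blast
  have "(\<lambda>x. r u x) \<in> borel_measurable borel"
    by (rule tame_measurable[OF assms]) auto
  note * = set_integral_nonneg_bounded[OF this, of 0 z K]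
  show "ennreal (LINT x:{0..z}|lborel. r u x) = (\<integral>\<^sup>+x\<in>{0..z}. ennreal (r u x) \<partial>lborel)"
    and "0 \<le> (LINT x:{0..z}|lborel. r u x)"
    using K tameD(2)[OF assms] by (intro *; simp)+
qed

lemma conv_slice:
  assumes "tame n r"
  shows "ennreal (LINT x:{0..z}|lborel. \<phi> x * r (y - x) z)
      = (\<integral>\<^sup>+x\<in>{0..z}. ennreal (\<phi> x * r (y - x) z) \<partial>lborel)"
    and "0 \<le> (LINT x:{0..z}|lborel. \<phi> x * r (y - x) z)"
proof -
  obtain K where K: "\<forall>y x. x \<le> z \<longrightarrow> r y x \<le> K" "K \<ge> 0"
    using tameD(3)[OF assms] by blast
  obtain B where B: "\<forall>x\<le>z. \<phi> x \<le> B" "B \<ge> 0"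
    using locally_bounded by blast
  have "(\<lambda>x. r (y - x) z) \<in> borel_measurable borel"
    by (rule tame_measurable[OF assms]) auto
  then have "(\<lambda>x. \<phi> x * r (y - x) z) \<in> borel_measurable borel"
    using measurable by measurable
  note * = set_integral_nonneg_bounded[OF this, of 0 z "B * K"]
  have "0 \<le> \<phi> x * r (y - x) z \<and> \<phi> x * r (y - x) z \<le> B * K" if "x \<in> {0..z}" for x
    using K B that tameD(2)[OF assms] nonneg by (auto intro!: mult_mono)
  with * show "ennreal (LINT x:{0..z}|lborel. \<phi> x * r (y - x) z)
      = (\<integral>\<^sup>+x\<in>{0..z}. ennreal (\<phi> x * r (y - x) z) \<partial>lborel)"
    and "0 \<le> (LINT x:{0..z}|lborel. \<phi> x * r (y - x) z)" by blast+
qed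

lemma step_nonneg: "tame n r \<Longrightarrow> 0 \<le> step r y z"
  unfolding step_def by (intro add_nonneg_nonneg mult_nonneg_nonneg snd_slice conv_slice nonneg)

text \<open>For \<open>x\<close> in \<open>{0..z}\<close>, membership of \<open>(y - z, x)\<close>
  or of \<open>(y - x, z)\<close> in \<open>D_set n\<close> forces \<open>(y, z)\<close> into
  \<open>D_set (Suc n)\<close>. Outside the latter both integrands therefore vanish
  identically.\<close>

lemma step_eq_0:
  assumes r: "tame n r" and "(y, z) \<notin> D_set (Suc n)"
  shows "step r y z = 0"
proof -
  have "r (y - z) x = 0" "r (y - x) z = 0" if x: "x \<in> {0..z}" for x
  proof -
    have "real n * x \<le> real n * z" using x by (auto intro: mult_left_mono)
    then show "r (y - z) x = 0" "r (y - x) z = 0"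
      using x assms(2) by (auto intro!: tameD(4)[OF r] simp: D_set_def algebra_simps)
  qed
  then have "(LINT x:{0..z}|lborel. r (y - z) x) = (LINT x:{0..z}|lborel. 0)"
      and "(LINT x:{0..z}|lborel. \<phi> x * r (y - x) z) = (LINT x:{0..z}|lborel. 0)"
    by (intro set_lebesgue_integral_cong; simp)+
  then show ?thesis by (simp add: step_def)
qed

lemma step_bounded:
  assumes r: "tame n r"
  shows "\<exists>K. \<forall>y z. z \<le> R \<longrightarrow> step r y z \<le> K"
proof -
  obtain K where K: "\<forall>y x. x \<le> R \<longrightarrow> r y x \<le> K" "K \<ge> 0"
    using tameD(3)[OF r] by blast
  obtain B where B: "\<forall>x\<le>R. \<phi> x \<le> B" "B \<ge> 0"
    using locally_bounded by blast
  \<comment> \<open>The interval \<open>{0..z}\<close> has length at most \<open>R\<close>, and the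
    two integrands are bounded by \<open>K\<close> and \<open>B * K\<close>.\<close>
  have "step r y z \<le> B * (K * R) + (B * K) * R" if z: "z \<le> R" "0 \<le> z" for y z
  proof -
    have m1: "(\<lambda>x. r (y - z) x) \<in> borel_measurable borel"
      and m2: "(\<lambda>x. r (y - x) z) \<in> borel_measurable borel"
      by (rule tame_measurable[OF r]; simp)+
    have m3: "(\<lambda>x. \<phi> x * r (y - x) z) \<in> borel_measurable borel"
      using m2 measurable by measurable
    have "(LINT x:{0..z}|lborel. r (y - z) x) \<le> K * (z - 0)"
      by (rule set_integral_nonneg_bounded(4)[OF m1]) (use K z tameD(2)[OF r] in auto)
    also have "\<dots> \<le> K * R" using K z by (intro mult_left_mono) auto
    finally have 1: "(LINT x:{0..z}|lborel. r (y - z) x) \<le> K * R" .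
    have "(LINT x:{0..z}|lborel. \<phi> x * r (y - x) z) \<le> (B * K) * (z - 0)"
      by (rule set_integral_nonneg_bounded(4)[OF m3])
        (use K B z tameD(2)[OF r] nonneg in \<open>auto intro!: mult_mono\<close>)
    also have "\<dots> \<le> (B * K) * R" using K B z by (intro mult_left_mono) auto
    finally have 2: "(LINT x:{0..z}|lborel. \<phi> x * r (y - x) z) \<le> (B * K) * R" .
    show ?thesis
      unfolding step_def using 1 2 B z
      by (intro add_mono mult_mono snd_slice(2)[OF r]) auto
  qed
  moreover have "step r y z = 0" if "z < 0" for y z
    using that step_eq_0[OF r] by (auto simp: D_set_def)
  \<comment> \<open>The \<open>max 0\<close> covers negative \<open>z\<close>, where the value is 0
    but the previous bound may be negative because \<open>R\<close> is.\<close>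
  ultimately have "step r y z \<le> max 0 (B * (K * R) + (B * K) * R)" if "z \<le> R" for y z
    using that by (cases "z < 0") (auto simp: le_max_iff_disj)
  then show ?thesis by blast
qed

lemma step_measurable:
  assumes r: "tame n r"
  shows "(\<lambda>(y, z). step r y z) \<in> borel_measurable (borel \<Otimes>\<^sub>M borel)"
proof -
  note [measurable] = measurable
  have [measurable]: "(\<lambda>p. r (fst (fst p) - snd (fst p)) (snd p)) \<in> borel_measurable ((borel \<Otimes>\<^sub>M borel) \<Otimes>\<^sub>M lborel)"
    "(\<lambda>p. r (fst (fst p) - snd p) (snd (fst p))) \<in> borel_measurable ((borel \<Otimes>\<^sub>M borel) \<Otimes>\<^sub>M lborel)"
    by (rule tame_measurable[OF r]; measurable)+
  have "(\<lambda>q. \<phi> (snd q) * (LINT x|lborel. (if 0 \<le> x \<and> x \<le> snd q then r (fst q - snd q) x else 0))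
     + (LINT x|lborel. (if 0 \<le> x \<and> x \<le> snd q then \<phi> x * r (fst q - x) (snd q) else 0)))
     \<in> borel_measurable (borel \<Otimes>\<^sub>M borel)"
    by measurable
  then show ?thesis
    unfolding step_def set_integral_eq_if by (simp add: case_prod_unfold)
qed

text \<open>Dominated convergence along sequences, in both integrals. Integration smooths: each
  integrand runs along a line that meets the discontinuity lines of \<open>r\<close> in single
  points, so the result is continuous at every point with \<open>z > 0\<close>, even on boundary
  lines. Positivity of \<open>z\<close> is there because \<open>\<phi>\<close> may jump at
  0.\<close>

lemma step_isCont:
  assumes r: "tame n r" and n: "n \<ge> 1" and z: "z > 0"
  shows "isCont (\<lambda>(y, z). step r y z) (y, z)"
  unfolding continuous_at_sequentially
proof (intro allI impI)
  fix q :: "nat \<Rightarrow> real \<times> real" assume q: "q \<longlonglongrightarrow> (y, z)"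
  define u v where "u k = fst (q k)" and "v k = snd (q k)" for k
  have u: "u \<longlonglongrightarrow> y" and v: "v \<longlonglongrightarrow> z"
    using tendsto_fst[OF q] tendsto_snd[OF q] by (simp_all add: u_def[abs_def] v_def[abs_def])
  have "bounded (range v)" using v by (rule convergent_imp_bounded)
  then obtain R where "\<forall>k. \<bar>v k\<bar> \<le> R" by (auto simp: bounded_iff)
  then have R: "v k \<le> R" for k by (metis abs_le_D1)
  obtain K where K: "\<forall>y x. x \<le> R \<longrightarrow> r y x \<le> K" "K \<ge> 0"
    using tameD(3)[OF r] by blast
  obtain B where B: "\<forall>x\<le>R. \<phi> x \<le> B" "B \<ge> 0"
    using locally_bounded by blast
  note [measurable] = measurable
  have [measurable]: "(\<lambda>x. r a x) \<in> borel_measurable borel"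
      "(\<lambda>x. r (a - x) b) \<in> borel_measurable borel" for a b
    by (rule tame_measurable[OF r]; simp)+
  have dom: "integrable lborel (\<lambda>x. indicator {0..R} x *\<^sub>R C)" for C :: real
    by (cases "0 \<le> R") auto
  \<comment> \<open>The moving endpoint \<open>v k\<close> is eventually on the same side of
    \<open>x\<close> as its limit \<open>z\<close>; only \<open>x = z\<close> can fail.\<close>
  have cut: "\<forall>\<^sub>F k in sequentially. (0 \<le> x \<and> x \<le> v k) = (0 \<le> x \<and> x \<le> z)" if "x \<noteq> z" for x
  proof (cases "x < z")
    case True
    from order_tendstoD(1)[OF v this] show ?thesis by eventually_elim (use True in auto)
  next
    case False
    with that have "z < x" by auto
    from order_tendstoD(2)[OF v this] show ?thesis by eventually_elim (use \<open>z < x\<close> in auto)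
  qed
  have "(\<lambda>k. LINT x:{0..v k}|lborel. r (u k - v k) x) \<longlonglongrightarrow> (LINT x:{0..z}|lborel. r (y - z) x)"
    unfolding set_integral_eq_if
  proof (rule integral_dominated_convergence[OF _ _ dom[of K]])
    \<comment> \<open>The last two values are where \<open>(y - z, x)\<close> meets the lines on
      which \<open>r\<close> may jump; \<open>n \<ge> 1\<close> makes the second of them a single
      point.\<close>
    have "AE x in lborel. x \<noteq> z \<and> x \<noteq> y - z \<and> x \<noteq> (y - z) / real n"
      by (intro AE_conjI AE_lborel_singleton)
    then show "AE x in lborel. (\<lambda>k. if 0 \<le> x \<and> x \<le> v k then r (u k - v k) x else 0)
        \<longlonglongrightarrow> (if 0 \<le> x \<and> x \<le> z then r (y - z) x else 0)"
    proof eventually_elim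
      case (elim x)
      have "(\<lambda>k. r (u k - v k) x) \<longlonglongrightarrow> r (y - z) x"
        by (rule tame_tendsto[OF r]) (use elim n in \<open>auto intro!: tendsto_intros u v simp: field_simps\<close>)
      then show ?case
        using elim by (intro tendsto_if_eventually_const cut) auto
    qed
    show "AE x in lborel. norm (if 0 \<le> x \<and> x \<le> v k then r (u k - v k) x else 0)
        \<le> indicator {0..R} x *\<^sub>R K" for k
      using R[of k] K tameD(2)[OF r] by (auto simp: indicator_def intro!: AE_I2)
  qed simp_all
  moreover have "(\<lambda>k. LINT x:{0..v k}|lborel. \<phi> x * r (u k - x) (v k))
      \<longlonglongrightarrow> (LINT x:{0..z}|lborel. \<phi> x * r (y - x) z)"
    unfolding set_integral_eq_if
  proof (rule integral_dominated_convergence[OF _ _ dom[of "B * K"]])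
    \<comment> \<open>Here the last two values are where \<open>(y - x, z)\<close> meets the same
      lines.\<close>
    have "AE x in lborel. x \<noteq> z \<and> x \<noteq> y - z \<and> x \<noteq> y - real n * z"
      by (intro AE_conjI AE_lborel_singleton)
    then show "AE x in lborel. (\<lambda>k. if 0 \<le> x \<and> x \<le> v k then \<phi> x * r (u k - x) (v k) else 0)
        \<longlonglongrightarrow> (if 0 \<le> x \<and> x \<le> z then \<phi> x * r (y - x) z else 0)"
    proof eventually_elim
      case (elim x)
      have "(\<lambda>k. \<phi> x * r (u k - x) (v k)) \<longlonglongrightarrow> \<phi> x * r (y - x) z"
        by (intro tendsto_mult tendsto_const tame_tendsto[OF r])
          (use elim n in \<open>auto intro!: tendsto_intros u v simp: field_simps\<close>)
      then show ?case
        using elim by (intro tendsto_if_eventually_const cut) auto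
    qed
    show "AE x in lborel. norm (if 0 \<le> x \<and> x \<le> v k then \<phi> x * r (u k - x) (v k) else 0)
        \<le> indicator {0..R} x *\<^sub>R (B * K)" for k
      using R[of k] K B tameD(2)[OF r] nonneg
      by (auto simp: indicator_def abs_mult intro!: AE_I2 mult_mono)
  qed simp_all
  moreover have "(\<lambda>k. \<phi> (v k)) \<longlonglongrightarrow> \<phi> z"
    by (rule isCont_tendsto_compose[OF isCont_pos[OF z] v])
  ultimately have "(\<lambda>k. step r (u k) (v k)) \<longlonglongrightarrow> step r y z"
    unfolding step_def by (intro tendsto_intros)
  then show "((\<lambda>(y, z). step r y z) \<circ> q) \<longlonglongrightarrow> (case (y, z) of (y, z) \<Rightarrow> step r y z)"
    by (simp add: u_def v_def case_prod_unfold comp_def)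
qed

lemma tame_step:
  assumes r: "tame n r" and n: "n \<ge> 1"
  shows "tame (Suc n) (step r)"
  unfolding tame_def
proof (intro conjI allI impI)
  fix y z :: real assume *: "y \<noteq> z" "y \<noteq> real (Suc n) * z"
  show "isCont (\<lambda>(y, z). step r y z) (y, z)"
  proof (cases "(y, z) \<in> D_set (Suc n)")
    case True
    \<comment> \<open>Inside \<open>D_set (Suc n)\<close>, \<open>z = 0\<close> would force
      \<open>y = 0\<close>, against \<open>y \<noteq> z\<close>.\<close>
    then have "z > 0" using * by (cases "z = 0") (auto simp: D_set_def)
    then show ?thesis by (rule step_isCont[OF r n])
  next
    case False
    show ?thesis
      by (rule isCont_zero_off_closed[OF closed_D_set False])
         (use step_eq_0[OF r] in \<open>auto simp: case_prod_unfold\<close>)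
  qed
qed (use step_measurable[OF r] step_nonneg[OF r] step_bounded[OF r] step_eq_0[OF r] in auto)

end

section \<open>The mixed partial derivative\<close>

text \<open>The density vanishes for negative first argument, so truncating at
  \<open>a \<le> 0\<close> loses nothing; \<open>a\<close> stays free so that it can be placed
  strictly below a point of differentiation. A fixed \<open>v\<close> excludes only two values of
  \<open>s\<close>, hence the continuity in \<open>v\<close> has no exceptional points.\<close>

lemma tame_set_integral_fst:
  assumes r: "tame n r" and a: "a \<le> 0"
  shows "set_integrable lborel {a..u} (\<lambda>s. r s v)"
    and "ennreal (LINT s:{a..u}|lborel. r s v) = (\<integral>\<^sup>+s. ennreal (r s v) * indicator {..u} s \<partial>lborel)"
    and "0 \<le> (LINT s:{a..u}|lborel. r s v)"
    and "\<exists>K\<ge>0. \<forall>v\<le>R. (LINT s:{a..u}|lborel. r s v) \<le> K"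
    and "isCont (\<lambda>v. LINT s:{a..u}|lborel. r s v) v"
proof -
  have m: "(\<lambda>s. r s v) \<in> borel_measurable borel" for v
    by (rule tame_measurable[OF r]) auto
  have s0: "r s v = 0" if "s < 0" for s v
    using that by (auto intro!: tameD(4)[OF r] simp: D_set_def)
  obtain K where K: "\<forall>y x. x \<le> v \<longrightarrow> r y x \<le> K"
    using tameD(3)[OF r] by blast
  note * = set_integral_nonneg_bounded[OF m, of a u v K]
  have **: "0 \<le> r x v \<and> r x v \<le> K" for x using K tameD(2)[OF r] by auto
  show "set_integrable lborel {a..u} (\<lambda>s. r s v)"
    and "0 \<le> (LINT s:{a..u}|lborel. r s v)"
    using ** by (blast intro: *)+
  have "(\<integral>\<^sup>+s\<in>{a..u}. ennreal (r s v) \<partial>lborel)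
      = (\<integral>\<^sup>+s. ennreal (r s v) * indicator {..u} s \<partial>lborel)"
    using a by (intro nn_integral_cong) (auto simp: indicator_def s0)
  then show "ennreal (LINT s:{a..u}|lborel. r s v)
      = (\<integral>\<^sup>+s. ennreal (r s v) * indicator {..u} s \<partial>lborel)"
    using ** *(2) by simp
  show "\<exists>K\<ge>0. \<forall>v\<le>R. (LINT s:{a..u}|lborel. r s v) \<le> K"
  proof -
    obtain L where L: "\<forall>y x. x \<le> R \<longrightarrow> r y x \<le> L" "L \<ge> 0"
      using tameD(3)[OF r] by blast
    have "(LINT s:{a..u}|lborel. r s v) \<le> max 0 (L * (u - a))" if "v \<le> R" for v
    proof (cases "a \<le> u")
      case True
      have "(LINT s:{a..u}|lborel. r s v) \<le> L * (u - a)"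
        by (rule set_integral_nonneg_bounded(4)[OF m _ True])
           (use L that tameD(2)[OF r] in auto)
      then show ?thesis by auto
    qed (auto simp: set_lebesgue_integral_def)
    then show ?thesis by (intro exI[of _ "max 0 (L * (u - a))"]) auto
  qed
  show "isCont (\<lambda>v. LINT s:{a..u}|lborel. r s v) v"
    unfolding continuous_at_sequentially comp_def
  proof (intro allI impI)
    fix w :: "nat \<Rightarrow> real" assume w: "w \<longlonglongrightarrow> v"
    have "bounded (range w)" using w by (rule convergent_imp_bounded)
    then obtain R where "\<forall>k. \<bar>w k\<bar> \<le> R" by (auto simp: bounded_iff)
    then have R: "w k \<le> R" for k by (metis abs_le_D1)
    obtain L where L: "\<forall>y x. x \<le> R \<longrightarrow> r y x \<le> L" "L \<ge> 0"
      using tameD(3)[OF r] by blast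
    show "(\<lambda>k. LINT s:{a..u}|lborel. r s (w k)) \<longlonglongrightarrow> (LINT s:{a..u}|lborel. r s v)"
      unfolding set_lebesgue_integral_def
    proof (rule integral_dominated_convergence[where w="\<lambda>s. indicator {a..u} s *\<^sub>R L"])
      have "AE s in lborel. s \<noteq> v \<and> s \<noteq> real n * v"
        by (intro AE_conjI AE_lborel_singleton)
      then show "AE s in lborel. (\<lambda>k. indicator {a..u} s *\<^sub>R r s (w k))
          \<longlonglongrightarrow> indicator {a..u} s *\<^sub>R r s v"
        by eventually_elim (auto intro!: tendsto_intros tame_tendsto[OF r] w)
      show "integrable lborel (\<lambda>s. indicator {a..u} s *\<^sub>R L)"
        by (cases "a \<le> u") auto
      show "AE s in lborel. norm (indicator {a..u} s *\<^sub>R r s (w k)) \<le> indicator {a..u} s *\<^sub>R L" for k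
        using L R[of k] tameD(2)[OF r] by (auto simp: indicator_def intro!: AE_I2)
    qed (use m in auto)
  qed
qed

lemma tame_has_mixed_partial:
  assumes r: "tame n r" and yz: "y \<noteq> z" "y \<noteq> real n * z"
    and G: "\<And>y z. 0 \<le> G y z"
      "\<And>y z. ennreal (G y z)
        = (\<integral>\<^sup>+w. (\<integral>\<^sup>+s. ennreal (r s w) * indicator {..y} s \<partial>lborel) * indicator {..z} w \<partial>lborel)"
  shows "has_mixed_partial G (r y z) y z"
proof -
  \<comment> \<open>Below 0, so that both truncations are harmless, and strictly below
    \<open>y\<close> and \<open>z\<close>, so that these are interior points of the integration
    intervals and the derivatives are two-sided.\<close>
  define a where "a = min 0 (min y z) - 1"
  have a: "a \<le> 0" "a < y" "a < z" by (auto simp: a_def)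
  define h where "h u v = (LINT s:{a..u}|lborel. r s v)" for u v
  note hI = tame_set_integral_fst[OF r a(1), folded h_def]
  have h_cont: "continuous_on A (h u)" for A u
    using hI(5) by (simp add: continuous_at_imp_continuous_on)
  have h_meas: "h u \<in> borel_measurable borel" for u
    using h_cont by (rule borel_measurable_continuous_onI)
  have h0: "h u v = 0" if "v < 0" for u v
  proof -
    have "r s v = 0" for s
      using that by (auto intro!: tameD(4)[OF r] simp: D_set_def)
    then show ?thesis by (simp add: h_def set_lebesgue_integral_def)
  qed
  have G_eq: "G u v = integral {a..v} (h u)" for u v
  proof -
    obtain K where K: "\<forall>x\<le>v. h u x \<le> K" using hI(4)[of v u] by blast
    have b: "0 \<le> h u x \<and> h u x \<le> K" if "x \<in> {a..v}" for x
      using hI(3) K that by auto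
    note * = set_integral_nonneg_bounded[OF h_meas, of a v u K]
    have "ennreal (G u v) = (\<integral>\<^sup>+w. ennreal (h u w) * indicator {..v} w \<partial>lborel)"
      unfolding G(2) hI(2) ..
    also have "\<dots> = (\<integral>\<^sup>+w\<in>{a..v}. ennreal (h u w) \<partial>lborel)"
      using a by (intro nn_integral_cong) (auto simp: indicator_def h0)
    also have "\<dots> = ennreal (LINT w:{a..v}|lborel. h u w)"
      using b by (rule *(2)[symmetric])
    finally have "G u v = (LINT w:{a..v}|lborel. h u w)"
      using G(1) *(3) b by (simp add: ennreal_inj)
    also have "\<dots> = integral {a..v} (h u)"
      using b by (intro set_borel_integral_eq_integral *(1)) auto
    finally show ?thesis .
  qed
  \<comment> \<open>As \<open>h u\<close> is continuous everywhere, this holds for every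
    \<open>u\<close>, hence in particular near \<open>y\<close>.\<close>
  have "((\<lambda>v. G u v) has_real_derivative h u z) (at z)" for u
  proof -
    have "((\<lambda>v. integral {a..v} (h u)) has_real_derivative h u z) (at z within {a..z+1})"
      using a by (intro integral_has_real_derivative h_cont) auto
    moreover have "at z within {a..z+1} = at z"
      using a by (intro at_within_interior) auto
    ultimately show ?thesis by (simp add: G_eq)
  qed
  moreover have "((\<lambda>u. h u z) has_real_derivative r y z) (at y)"
  proof -
    have eq: "h u z = integral {a..u} (\<lambda>s. r s z)" for u
      unfolding h_def by (intro set_borel_integral_eq_integral hI(1))
    \<comment> \<open>The integrand may jump elsewhere on the interval, so the pointwise form of the
      fundamental theorem is used: integrability together with continuity at \<open>y\<close> alone.
      The removed set \<open>{}\<close> is the exceptional set of that rule.\<close>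
    have "((\<lambda>u. integral {a..u} (\<lambda>s. r s z)) has_vector_derivative r y z) (at y within {a..y+1} - {})"
    proof (rule integral_has_vector_derivative_continuous_at)
      show "(\<lambda>s. r s z) integrable_on {a..y+1}"
        by (intro set_borel_integral_eq_integral hI(1))
      have "isCont (\<lambda>s. r s z) y"
        unfolding isCont_def by (rule tame_tendsto[OF r yz]) (auto intro!: tendsto_intros)
      then show "continuous (at y within {a..y+1} - {}) (\<lambda>s. r s z)"
        by (rule continuous_at_imp_continuous_at_within)
    qed (use a in auto)
    moreover have "at y within {a..y+1} = at y"
      using a by (intro at_within_interior) auto
    ultimately show ?thesis
      by (simp add: eq has_real_derivative_iff_has_vector_derivative)
  qed
  ultimately show ?thesis
    unfolding has_mixed_partial_def by (intro exI[of _ "\<lambda>u. h u z"]) auto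
qed

lemma has_mixed_partial_shift:
  assumes "has_mixed_partial G D (y + a) (z + b)"
  shows "has_mixed_partial (\<lambda>y z. G (y + a) (z + b)) D y z"
proof -
  obtain H where H: "\<forall>\<^sub>F u in nhds (y + a). ((\<lambda>v. G u v) has_real_derivative H u) (at (z + b))"
      "(H has_real_derivative D) (at (y + a))"
    using assms unfolding has_mixed_partial_def by blast
  have "filterlim (\<lambda>u. u + a) (nhds (y + a)) (nhds y)"
    by (intro tendsto_intros filterlim_ident)
  from eventually_compose_filterlim[OF H(1) this]
  have "\<forall>\<^sub>F u in nhds y. ((\<lambda>v. G (u + a) (v + b)) has_real_derivative H (u + a)) (at z)"
    by eventually_elim (simp add: DERIV_shift)
  moreover have "((\<lambda>u. H (u + a)) has_real_derivative D) (at y)"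
    using H(2) by (simp add: DERIV_shift)
  ultimately show ?thesis
    unfolding has_mixed_partial_def by (intro exI[of _ "\<lambda>u. H (u + a)"]) auto
qed

section \<open>Changes of variables and the density recursion against test functions\<close>

lemma nn_integral_lborel_translate:
  fixes h :: "real \<Rightarrow> ennreal"
  assumes "h \<in> borel_measurable borel"
  shows "(\<integral>\<^sup>+x. h (x + a) \<partial>lborel) = (\<integral>\<^sup>+x. h x \<partial>lborel)"
  using nn_integral_real_affine[OF assms, of 1 a] by (simp add: add.commute)

lemma nn_integral_indicator_times:
  fixes r :: "real \<Rightarrow> real \<Rightarrow> ennreal"
  shows "(\<integral>\<^sup>+w. (\<integral>\<^sup>+s. indicator ({..y} \<times> {..z}) (s, w) * r s w \<partial>lborel) \<partial>lborel)
    = (\<integral>\<^sup>+w. (\<integral>\<^sup>+s. r s w * indicator {..y} s \<partial>lborel) * indicator {..z} w \<partial>lborel)"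
  by (intro nn_integral_cong)
     (auto simp: indicator_def mult.commute intro!: nn_integral_cong split: if_splits)

text \<open>If \<open>(S, W)\<close> has density \<open>r\<close> and an independent
  \<open>x\<close> has density \<open>\<phi>\<close>, then \<open>(S + x, max W x)\<close> has
  density \<open>step r\<close>. The proof substitutes \<open>y = s + x\<close>, splits according to
  which of \<open>w\<close> and \<open>x\<close> is the maximum, and reorders the integrals by
  Tonelli.\<close>

lemma nn_integral_step:
  assumes "nonneg_density \<phi>" and r: "tame n r" and [measurable]: "\<Phi> \<in> borel_measurable (borel \<Otimes>\<^sub>M borel)"
  shows "(\<integral>\<^sup>+x. ennreal (\<phi> x) * (\<integral>\<^sup>+w. \<integral>\<^sup>+s. \<Phi> (s + x, max w x) * ennreal (r s w) \<partial>lborel \<partial>lborel) \<partial>lborel)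
    = (\<integral>\<^sup>+z. \<integral>\<^sup>+y. \<Phi> (y, z) * ennreal (nonneg_density.step \<phi> r y z) \<partial>lborel \<partial>lborel)"
proof -
  interpret nonneg_density \<phi> by fact
  note [measurable] = measurable
  define q where "q p = ennreal (case p of (s, w) \<Rightarrow> r s w)" for p
  have [measurable]: "q \<in> borel_measurable (borel \<Otimes>\<^sub>M borel)"
    unfolding q_def using tameD(1)[OF r] by measurable
  have q0: "q (s, w) = 0" if "w < 0" for s w
    using that tameD(4)[OF r, of s w] by (simp add: q_def D_set_def)
  \<comment> \<open>In \<open>E1\<close> the new value \<open>x\<close> is the maximum, in
    \<open>E2\<close> the old maximum \<open>w\<close> persists. They become the two summands of
    \<open>step\<close>.\<close>
  define E1 where "E1 = (\<lambda>(x, w, y). if 0 \<le> w \<and> w \<le> x then ennreal (\<phi> x) * (\<Phi> (y, x) * q (y - x, w)) else 0)"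
  define E2 where "E2 = (\<lambda>(x, w, y). if 0 \<le> x \<and> x \<le> w then ennreal (\<phi> x) * (\<Phi> (y, w) * q (y - x, w)) else 0)"
  have [measurable]: "E1 \<in> borel_measurable (borel \<Otimes>\<^sub>M borel \<Otimes>\<^sub>M borel)"
      "E2 \<in> borel_measurable (borel \<Otimes>\<^sub>M borel \<Otimes>\<^sub>M borel)"
    unfolding E1_def E2_def by measurable
  have "(\<integral>\<^sup>+x. ennreal (\<phi> x) * (\<integral>\<^sup>+w. \<integral>\<^sup>+s. \<Phi> (s + x, max w x) * ennreal (r s w) \<partial>lborel \<partial>lborel) \<partial>lborel)
      = (\<integral>\<^sup>+x. (\<integral>\<^sup>+w. (\<integral>\<^sup>+y. E1 (x, w, y) \<partial>lborel) + (\<integral>\<^sup>+y. E2 (x, w, y) \<partial>lborel) \<partial>lborel) \<partial>lborel)"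
  proof (rule nn_integral_cong)
    fix x
    have "ennreal (\<phi> x) * (\<integral>\<^sup>+w. \<integral>\<^sup>+s. \<Phi> (s + x, max w x) * ennreal (r s w) \<partial>lborel \<partial>lborel)
        = (\<integral>\<^sup>+w. \<integral>\<^sup>+s. ennreal (\<phi> x) * (\<Phi> (s + x, max w x) * q (s, w)) \<partial>lborel \<partial>lborel)"
      by (simp add: nn_integral_cmult q_def[symmetric, of "(a, b)" for a b, simplified])
    also have "\<dots> = (\<integral>\<^sup>+w. \<integral>\<^sup>+y. ennreal (\<phi> x) * (\<Phi> (y, max w x) * q (y - x, w)) \<partial>lborel \<partial>lborel)"
    proof (rule nn_integral_cong)
      fix w
      have "(\<lambda>y. ennreal (\<phi> x) * (\<Phi> (y, max w x) * q (y - x, w))) \<in> borel_measurable borel"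
        by measurable
      from nn_integral_lborel_translate[OF this, of x]
      show "(\<integral>\<^sup>+s. ennreal (\<phi> x) * (\<Phi> (s + x, max w x) * q (s, w)) \<partial>lborel)
        = (\<integral>\<^sup>+y. ennreal (\<phi> x) * (\<Phi> (y, max w x) * q (y - x, w)) \<partial>lborel)" by simp
    qed
    also have "\<dots> = (\<integral>\<^sup>+w. (\<integral>\<^sup>+y. E1 (x, w, y) \<partial>lborel) + (\<integral>\<^sup>+y. E2 (x, w, y) \<partial>lborel) \<partial>lborel)"
    proof (rule nn_integral_cong_AE)
      show "AE w in lborel. (\<integral>\<^sup>+y. ennreal (\<phi> x) * (\<Phi> (y, max w x) * q (y - x, w)) \<partial>lborel)
          = (\<integral>\<^sup>+y. E1 (x, w, y) \<partial>lborel) + (\<integral>\<^sup>+y. E2 (x, w, y) \<partial>lborel)"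
        using AE_lborel_singleton[of x]
      proof eventually_elim
        case (elim w)
        \<comment> \<open>The tie \<open>w = x\<close> could be counted twice and is discarded as a
          null set. The sign conditions in \<open>E1\<close> and \<open>E2\<close> lose nothing,
          since \<open>q\<close> vanishes for \<open>w < 0\<close> and \<open>\<phi>\<close> for
          \<open>x < 0\<close>.\<close>
        have "ennreal (\<phi> x) * (\<Phi> (y, max w x) * q (y - x, w)) = E1 (x, w, y) + E2 (x, w, y)" for y
          using elim by (cases w x rule: linorder_cases) (auto simp: E1_def E2_def q0 neg max_def)
        then show ?case by (simp add: nn_integral_add)
      qed
    qed
    finally show "ennreal (\<phi> x) * (\<integral>\<^sup>+w. \<integral>\<^sup>+s. \<Phi> (s + x, max w x) * ennreal (r s w) \<partial>lborel \<partial>lborel)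
      = (\<integral>\<^sup>+w. (\<integral>\<^sup>+y. E1 (x, w, y) \<partial>lborel) + (\<integral>\<^sup>+y. E2 (x, w, y) \<partial>lborel) \<partial>lborel)" .
  qed
  also have "\<dots> = (\<integral>\<^sup>+x. \<integral>\<^sup>+w. \<integral>\<^sup>+y. E1 (x, w, y) \<partial>lborel \<partial>lborel \<partial>lborel)
      + (\<integral>\<^sup>+x. \<integral>\<^sup>+w. \<integral>\<^sup>+y. E2 (x, w, y) \<partial>lborel \<partial>lborel \<partial>lborel)"
    by (simp add: nn_integral_add)
  \<comment> \<open>In \<open>E1\<close> the maximum is the first argument, so swapping the two
    inner integrals suffices; in \<open>E2\<close> it is the second, so the outer integrals are
    swapped as well.\<close>
  also have "(\<integral>\<^sup>+x. \<integral>\<^sup>+w. \<integral>\<^sup>+y. E1 (x, w, y) \<partial>lborel \<partial>lborel \<partial>lborel)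
      = (\<integral>\<^sup>+z. \<integral>\<^sup>+y. \<integral>\<^sup>+x. E1 (z, x, y) \<partial>lborel \<partial>lborel \<partial>lborel)"
    by (intro nn_integral_cong lborel_pair.Fubini') measurable
  also have "(\<integral>\<^sup>+x. \<integral>\<^sup>+w. \<integral>\<^sup>+y. E2 (x, w, y) \<partial>lborel \<partial>lborel \<partial>lborel)
      = (\<integral>\<^sup>+z. \<integral>\<^sup>+x. \<integral>\<^sup>+y. E2 (x, z, y) \<partial>lborel \<partial>lborel \<partial>lborel)"
    by (intro lborel_pair.Fubini') measurable
  also have "(\<integral>\<^sup>+z. \<integral>\<^sup>+x. \<integral>\<^sup>+y. E2 (x, z, y) \<partial>lborel \<partial>lborel \<partial>lborel)
      = (\<integral>\<^sup>+z. \<integral>\<^sup>+y. \<integral>\<^sup>+x. E2 (x, z, y) \<partial>lborel \<partial>lborel \<partial>lborel)"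
    by (intro nn_integral_cong lborel_pair.Fubini') measurable
  also have "(\<integral>\<^sup>+z. \<integral>\<^sup>+y. \<integral>\<^sup>+x. E1 (z, x, y) \<partial>lborel \<partial>lborel \<partial>lborel) + \<dots>
      = (\<integral>\<^sup>+z. \<integral>\<^sup>+y. (\<integral>\<^sup>+x. E1 (z, x, y) \<partial>lborel) + (\<integral>\<^sup>+x. E2 (x, z, y) \<partial>lborel) \<partial>lborel \<partial>lborel)"
    by (simp add: nn_integral_add)
  also have "\<dots> = (\<integral>\<^sup>+z. \<integral>\<^sup>+y. \<Phi> (y, z) * ennreal (step r y z) \<partial>lborel \<partial>lborel)"
  proof (intro nn_integral_cong)
    fix y z
    have "(\<integral>\<^sup>+x. E1 (z, x, y) \<partial>lborel)
        = (\<integral>\<^sup>+x. \<Phi> (y, z) * (ennreal (\<phi> z) * (q (y - z, x) * indicator {0..z} x)) \<partial>lborel)"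
      by (intro nn_integral_cong) (auto simp: E1_def indicator_def ac_simps)
    also have "\<dots> = \<Phi> (y, z) * (ennreal (\<phi> z) * (\<integral>\<^sup>+x\<in>{0..z}. q (y - z, x) \<partial>lborel))"
      by (simp add: nn_integral_cmult)
    also have "\<dots> = \<Phi> (y, z) * ennreal (\<phi> z * (LINT x:{0..z}|lborel. r (y - z) x))"
      using snd_slice[OF r] nonneg by (simp add: q_def ennreal_mult)
    finally have 1: "(\<integral>\<^sup>+x. E1 (z, x, y) \<partial>lborel)
        = \<Phi> (y, z) * ennreal (\<phi> z * (LINT x:{0..z}|lborel. r (y - z) x))" .
    have "(\<integral>\<^sup>+x. E2 (x, z, y) \<partial>lborel)
        = (\<integral>\<^sup>+x. \<Phi> (y, z) * ((ennreal (\<phi> x) * q (y - x, z)) * indicator {0..z} x) \<partial>lborel)"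
      by (intro nn_integral_cong) (auto simp: E2_def indicator_def ac_simps)
    also have "\<dots> = \<Phi> (y, z) * (\<integral>\<^sup>+x\<in>{0..z}. ennreal (\<phi> x) * q (y - x, z) \<partial>lborel)"
      by (simp add: nn_integral_cmult)
    also have "\<dots> = \<Phi> (y, z) * ennreal (LINT x:{0..z}|lborel. \<phi> x * r (y - x) z)"
      using conv_slice[OF r] nonneg tameD(2)[OF r] by (simp add: q_def ennreal_mult)
    finally have 2: "(\<integral>\<^sup>+x. E2 (x, z, y) \<partial>lborel)
        = \<Phi> (y, z) * ennreal (LINT x:{0..z}|lborel. \<phi> x * r (y - x) z)" .
    show "(\<integral>\<^sup>+x. E1 (z, x, y) \<partial>lborel) + (\<integral>\<^sup>+x. E2 (x, z, y) \<partial>lborel)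
        = \<Phi> (y, z) * ennreal (step r y z)"
      unfolding 1 2 step_def using snd_slice(2)[OF r] conv_slice(2)[OF r] nonneg
      by (simp add: distrib_left)
  qed
  finally show ?thesis .
qed

lemma distributedI_nn_integral:
  assumes [measurable]: "W \<in> measurable M N" "g \<in> borel_measurable N"
    and eq: "\<And>A. A \<in> sets N \<Longrightarrow> (\<integral>\<^sup>+\<omega>. indicator A (W \<omega>) \<partial>M) = (\<integral>\<^sup>+x. indicator A x * g x \<partial>N)"
  shows "distributed M N W g"
  unfolding distributed_def
proof (intro conjI measure_eqI)
  fix A assume "A \<in> sets (distr M N W)"
  then have [measurable]: "A \<in> sets N" by simp
  have "emeasure (distr M N W) A = (\<integral>\<^sup>+\<omega>. indicator A (W \<omega>) \<partial>M)"
    by (simp add: nn_integral_indicator[symmetric] nn_integral_distr del: nn_integral_indicator)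
  then show "emeasure (distr M N W) A = emeasure (density N g) A"
    by (simp add: eq emeasure_density mult.commute)
qed simp_all

section \<open>The densities \<open>g_fun\<close>: the base case \<open>n = 2\<close> and the
  passage to \<open>step\<close>\<close>

locale nonneg_densities =
  fixes f :: "nat \<Rightarrow> real \<Rightarrow> real"
  assumes density: "i \<ge> 1 \<Longrightarrow> nonneg_density (f i)"
begin

text \<open>Here the delta factor of \<open>g_fun f 1\<close> is integrated out. On
  \<open>D_set 2\<close> one has \<open>0 \<le> y - z \<le> z\<close>, so both delta integrals pick
  up their full mass.\<close>

lemma reg_part_g_fun_2:
  "reg_part (g_fun f 2) y z
    = (if (y, z) \<in> D_set 2 then f 2 z * f 1 (y - z) + f 2 (y - z) * f 1 z else 0)"
proof -
  have "g_fun f 2 = g_fun f (Suc (Suc 0))" by (simp add: numeral_2_eq_2)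
  then show ?thesis
    using snd_integral_g1[of f z "y - z"] conv_integral_g1[of f z y]
    by (auto simp: D_set_def numeral_2_eq_2)
qed

lemma delta_coeff_g_fun: "n \<ge> 2 \<Longrightarrow> delta_coeff (g_fun f n) = (\<lambda>y z. 0)"
  by (cases "(f, n)" rule: g_fun.cases) auto

text \<open>Induction on tameness starts at 2, the first index whose density is an ordinary
  function. Off the two boundary lines, a point of \<open>D_set 2\<close> is interior and all
  arguments of \<open>f 1\<close> and \<open>f 2\<close> are positive, hence points of
  continuity.\<close>

lemma tame_g_fun_2: "tame 2 (reg_part (g_fun f 2))"
proof -
  interpret f1: nonneg_density "f 1" by (rule density) simp
  interpret f2: nonneg_density "f 2" by (rule density) simp
  let ?h = "\<lambda>y z. f 2 z * f 1 (y - z) + f 2 (y - z) * f 1 z"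
  show ?thesis
    unfolding tame_def reg_part_g_fun_2
  proof (intro conjI allI impI)
    have [measurable]: "f 1 \<in> borel_measurable borel" "f 2 \<in> borel_measurable borel"
      by (rule f1.measurable f2.measurable)+
    have "(\<lambda>p. if 0 \<le> fst p \<and> 0 \<le> snd p \<and> snd p \<le> fst p \<and> fst p \<le> 2 * snd p
        then ?h (fst p) (snd p) else 0) \<in> borel_measurable (borel \<Otimes>\<^sub>M borel)"
      by measurable
    then show "(\<lambda>(y, z). if (y, z) \<in> D_set 2 then ?h y z else 0)
        \<in> borel_measurable (borel \<Otimes>\<^sub>M borel)"
      by (simp add: case_prod_unfold D_set_def)
  next
    fix y z show "0 \<le> (if (y, z) \<in> D_set 2 then ?h y z else 0)"
      by (simp add: f1.nonneg f2.nonneg del: One_nat_def)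
  next
    fix R
    obtain B1 where B1: "\<forall>x\<le>R. f 1 x \<le> B1" "B1 \<ge> 0" using f1.locally_bounded by blast
    obtain B2 where B2: "\<forall>x\<le>R. f 2 x \<le> B2" "B2 \<ge> 0" using f2.locally_bounded by blast
    show "\<exists>K. \<forall>y z. z \<le> R \<longrightarrow> (if (y, z) \<in> D_set 2 then ?h y z else 0) \<le> K"
    proof (intro exI[of _ "B2 * B1 + B2 * B1"] allI impI)
      fix y z assume "z \<le> R"
      \<comment> \<open>On \<open>D_set 2\<close> also \<open>y - z\<close> is at most
        \<open>z\<close>, so every argument is at most \<open>R\<close>.\<close>
      have "?h y z \<le> B2 * B1 + B2 * B1" if "y - z \<le> z"
        using B1 B2 that \<open>z \<le> R\<close>
        by (intro add_mono mult_mono f1.nonneg f2.nonneg) auto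
      then show "(if (y, z) \<in> D_set 2 then ?h y z else 0) \<le> B2 * B1 + B2 * B1"
        using B1 B2 by (auto simp: D_set_def simp del: One_nat_def)
    qed
  next
    fix y z :: real assume *: "y \<noteq> z" "y \<noteq> real 2 * z"
    show "isCont (\<lambda>(y, z). if (y, z) \<in> D_set 2 then ?h y z else 0) (y, z)"
    proof (cases "(y, z) \<in> D_set 2")
      case True
      then have pos: "z > 0" "y - z > 0" "y < 2 * z" using * by (auto simp: D_set_def)
      have "open ({p. 0 < snd p} \<inter> {p. snd p < fst p} \<inter> {p. fst p < 2 * snd p} :: (real \<times> real) set)"
        by (intro open_Int open_Collect_less continuous_intros)
      from eventually_nhds_in_open[OF this, of "(y, z)"]
      have "\<forall>\<^sub>F p in nhds (y, z). (case p of (y, z) \<Rightarrow> if (y, z) \<in> D_set 2 then ?h y z else 0)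
          = ?h (fst p) (snd p)"
        using pos by (auto elim!: eventually_mono simp: D_set_def case_prod_unfold)
      moreover have "isCont (\<lambda>p. ?h (fst p) (snd p)) (y, z)"
      proof -
        have c: "isCont (\<lambda>p. fst p - snd p) (y, z)" "isCont (\<lambda>p. snd p) (y, z)"
          by (intro continuous_intros)+
        have "isCont (\<lambda>p. f i (fst p - snd p)) (y, z)" "isCont (\<lambda>p. f i (snd p)) (y, z)"
          if "i \<ge> 1" for i
          using pos nonneg_density.isCont_pos[OF density[OF that]]
            isCont_o2[OF c(1), of "f i"] isCont_o2[OF c(2), of "f i"] by simp_all
        then show ?thesis by (intro isCont_add isCont_mult) auto
      qed
      ultimately show ?thesis by (subst isCont_cong) auto
    next
      case False
      show ?thesis
        by (rule isCont_zero_off_closed[OF closed_D_set False]) auto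
    qed
  qed auto
qed

text \<open>For \<open>n \<ge> 2\<close> the delta coefficient is zero, which leaves the ordinary
  integrals, and \<open>step_eq_0\<close> accounts for the cutoff to
  \<open>D_set (Suc n)\<close>.\<close>

lemma reg_part_g_fun_Suc:
  assumes n: "n \<ge> 2" and r: "tame n (reg_part (g_fun f n))"
  shows "reg_part (g_fun f (Suc n)) = nonneg_density.step (f (Suc n)) (reg_part (g_fun f n))"
proof (intro ext)
  fix y z
  interpret nonneg_density "f (Suc n)" by (rule density) simp
  obtain m where m: "n = Suc m" using n by (cases n) auto
  show "reg_part (g_fun f (Suc n)) y z = step (reg_part (g_fun f n)) y z"
    using delta_coeff_g_fun[OF n, unfolded m] step_eq_0[OF r, of y z, unfolded m]
    by (auto simp: m step_def[unfolded m] snd_integral_def conv_integral_def delta_integral_def)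
qed

lemma tame_g_fun: "n \<ge> 2 \<Longrightarrow> tame n (reg_part (g_fun f n))"
proof (induction n rule: nat_induct_at_least)
  case base
  show ?case by (rule tame_g_fun_2)
next
  case (Suc n)
  interpret nonneg_density "f (Suc n)" by (rule density) simp
  show ?case
    using Suc tame_step[OF Suc.IH] by (simp add: reg_part_g_fun_Suc)
qed

text \<open>The counterpart of \<open>nn_integral_step\<close> when the first pair lies on the
  diagonal, sum and maximum both being \<open>a\<close>; one integration fewer occurs, so it is
  proved separately.\<close>

lemma nn_integral_g_fun_2:
  assumes [measurable]: "\<Phi> \<in> borel_measurable (borel \<Otimes>\<^sub>M borel)"
  shows "(\<integral>\<^sup>+x. ennreal (f 2 x) * (\<integral>\<^sup>+a. ennreal (f 1 a) * \<Phi> (a + x, max a x) \<partial>lborel) \<partial>lborel)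
    = (\<integral>\<^sup>+z. \<integral>\<^sup>+y. \<Phi> (y, z) * ennreal (reg_part (g_fun f 2) y z) \<partial>lborel \<partial>lborel)"
proof -
  interpret f1: nonneg_density "f 1" by (rule density) simp
  interpret f2: nonneg_density "f 2" by (rule density) simp
  note [measurable] = f1.measurable f2.measurable
  \<comment> \<open>The first argument is the maximum and \<open>y\<close> is the sum, so the
    smaller summand is their difference. \<open>E1\<close> has the second variable as maximum,
    \<open>E2\<close> the first.\<close>
  define E1 where "E1 = (\<lambda>(x, y). if y - x \<le> x then ennreal (f 2 x) * (ennreal (f 1 (y - x)) * \<Phi> (y, x)) else 0)"
  define E2 where "E2 = (\<lambda>(a, y). if y - a \<le> a then ennreal (f 2 (y - a)) * (ennreal (f 1 a) * \<Phi> (y, a)) else 0)"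
  have [measurable]: "E1 \<in> borel_measurable (borel \<Otimes>\<^sub>M borel)" "E2 \<in> borel_measurable (borel \<Otimes>\<^sub>M borel)"
    unfolding E1_def E2_def by measurable
  have "(\<integral>\<^sup>+x. ennreal (f 2 x) * (\<integral>\<^sup>+a. ennreal (f 1 a) * \<Phi> (a + x, max a x) \<partial>lborel) \<partial>lborel)
      = (\<integral>\<^sup>+x. (\<integral>\<^sup>+a. E1 (x, a + x) \<partial>lborel) + (\<integral>\<^sup>+a. E2 (a, x + a) \<partial>lborel) \<partial>lborel)"
  proof (rule nn_integral_cong)
    fix x
    have "ennreal (f 2 x) * (\<integral>\<^sup>+a. ennreal (f 1 a) * \<Phi> (a + x, max a x) \<partial>lborel)
      = (\<integral>\<^sup>+a. ennreal (f 2 x) * (ennreal (f 1 a) * \<Phi> (a + x, max a x)) \<partial>lborel)"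
      by (rule nn_integral_cmult[symmetric]) measurable
    also have "\<dots> = (\<integral>\<^sup>+a. E1 (x, a + x) + E2 (a, x + a) \<partial>lborel)"
    proof (rule nn_integral_cong_AE)
      show "AE a in lborel. ennreal (f 2 x) * (ennreal (f 1 a) * \<Phi> (a + x, max a x))
          = E1 (x, a + x) + E2 (a, x + a)"
        using AE_lborel_singleton[of x]
        by eventually_elim (auto simp: E1_def E2_def max_def add.commute)
    qed
    also have "\<dots> = (\<integral>\<^sup>+a. E1 (x, a + x) \<partial>lborel) + (\<integral>\<^sup>+a. E2 (a, x + a) \<partial>lborel)"
      by (simp add: nn_integral_add)
    finally show "ennreal (f 2 x) * (\<integral>\<^sup>+a. ennreal (f 1 a) * \<Phi> (a + x, max a x) \<partial>lborel)
        = (\<integral>\<^sup>+a. E1 (x, a + x) \<partial>lborel) + (\<integral>\<^sup>+a. E2 (a, x + a) \<partial>lborel)" .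
  qed
  also have "\<dots> = (\<integral>\<^sup>+x. \<integral>\<^sup>+a. E1 (x, a + x) \<partial>lborel \<partial>lborel) + (\<integral>\<^sup>+x. \<integral>\<^sup>+a. E2 (a, x + a) \<partial>lborel \<partial>lborel)"
    by (simp add: nn_integral_add)
  also have "(\<integral>\<^sup>+x. \<integral>\<^sup>+a. E2 (a, x + a) \<partial>lborel \<partial>lborel) = (\<integral>\<^sup>+a. \<integral>\<^sup>+x. E2 (a, x + a) \<partial>lborel \<partial>lborel)"
    by (intro lborel_pair.Fubini') measurable
  also have "\<dots> = (\<integral>\<^sup>+z. \<integral>\<^sup>+y. E2 (z, y) \<partial>lborel \<partial>lborel)"
    by (intro nn_integral_cong nn_integral_lborel_translate) measurable
  also have "(\<integral>\<^sup>+x. \<integral>\<^sup>+a. E1 (x, a + x) \<partial>lborel \<partial>lborel) = (\<integral>\<^sup>+z. \<integral>\<^sup>+y. E1 (z, y) \<partial>lborel \<partial>lborel)"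
    by (intro nn_integral_cong nn_integral_lborel_translate) measurable
  also have "(\<integral>\<^sup>+z. \<integral>\<^sup>+y. E1 (z, y) \<partial>lborel \<partial>lborel) + (\<integral>\<^sup>+z. \<integral>\<^sup>+y. E2 (z, y) \<partial>lborel \<partial>lborel)
      = (\<integral>\<^sup>+z. \<integral>\<^sup>+y. E1 (z, y) + E2 (z, y) \<partial>lborel \<partial>lborel)"
    by (simp add: nn_integral_add)
  also have "\<dots> = (\<integral>\<^sup>+z. \<integral>\<^sup>+y. \<Phi> (y, z) * ennreal (reg_part (g_fun f 2) y z) \<partial>lborel \<partial>lborel)"
  proof (intro nn_integral_cong)
    fix y z
    show "E1 (z, y) + E2 (z, y) = \<Phi> (y, z) * ennreal (reg_part (g_fun f 2) y z)"
    proof (cases "(y, z) \<in> D_set 2")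
      case True
      then have "ennreal (reg_part (g_fun f 2) y z)
          = ennreal (f 2 z) * ennreal (f 1 (y - z)) + ennreal (f 2 (y - z)) * ennreal (f 1 z)"
        using f1.nonneg f2.nonneg by (simp add: reg_part_g_fun_2 ennreal_mult del: One_nat_def)
      then show ?thesis
        using True by (auto simp: E1_def E2_def D_set_def distrib_left ac_simps)
    next
      case False
      \<comment> \<open>In the first case both conditions in \<open>E1\<close> and \<open>E2\<close>
        fail; in the others each term has a PDF factor at a negative argument.\<close>
      then have "y - z > z \<or> z < 0 \<or> y - z < 0" by (auto simp: D_set_def)
      then show ?thesis
        using False f1.neg f2.neg by (auto simp: E1_def E2_def reg_part_g_fun_2 simp del: One_nat_def)
    qed
  qed
  finally show ?thesis .
qed

end

section \<open>Joint law of the sum and the maximum\<close>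

text \<open>\<open>U i\<close> stands for \<open>X i + c\<close>. Its nonnegativity is encoded in
  the vanishing of \<open>f i\<close> on the negative numbers.\<close>

locale nonneg_indep_seq = prob_space M + nonneg_densities f
  for M :: "'a measure" and f :: "nat \<Rightarrow> real \<Rightarrow> real" +
  fixes U :: "nat \<Rightarrow> 'a \<Rightarrow> real"
  assumes indep: "indep_vars (\<lambda>_. borel) U {1..}"
    and law: "i \<ge> 1 \<Longrightarrow> distributed M lborel (U i) (\<lambda>x. ennreal (f i x))"
begin

lemma U_measurable: "i \<ge> 1 \<Longrightarrow> U i \<in> borel_measurable M"
  using law[of i] by (auto simp: distributed_def)

lemma partial_sum_measurable[measurable]: "partial_sum U n \<in> borel_measurable M"
  unfolding partial_sum_def[abs_def] by (intro borel_measurable_sum U_measurable) auto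

lemma partial_max_measurable[measurable]: "partial_max U n \<in> borel_measurable M"
  unfolding partial_max_def[abs_def] by (intro borel_measurable_Max U_measurable) auto

lemma partial_sum_Suc: "partial_sum U (Suc n) \<omega> = partial_sum U n \<omega> + U (Suc n) \<omega>"
  by (simp add: partial_sum_def)

lemma partial_max_Suc:
  assumes "n \<ge> 1"
  shows "partial_max U (Suc n) \<omega> = max (partial_max U n \<omega>) (U (Suc n) \<omega>)"
proof -
  have "(\<lambda>i. U i \<omega>) ` {1..Suc n} = insert (U (Suc n) \<omega>) ((\<lambda>i. U i \<omega>) ` {1..n})"
    by (simp add: atLeastAtMostSuc_conv)
  then show ?thesis using assms by (simp add: partial_max_def max.commute)
qed

text \<open>Conditioning on the last variable. By independence the first \<open>n\<close> variables
  and the last one have a product law, so the integral equals one over two independent sample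
  points, the second of which is then replaced by the density of \<open>U (Suc n)\<close>.\<close>

lemma nn_integral_Suc:
  assumes n: "n \<ge> 1" and [measurable]: "\<Phi> \<in> borel_measurable (borel \<Otimes>\<^sub>M borel)"
  shows "(\<integral>\<^sup>+\<omega>. \<Phi> (partial_sum U (Suc n) \<omega>, partial_max U (Suc n) \<omega>) \<partial>M)
    = (\<integral>\<^sup>+x. ennreal (f (Suc n) x)
        * (\<integral>\<^sup>+\<omega>. \<Phi> (partial_sum U n \<omega> + x, max (partial_max U n \<omega>) x) \<partial>M) \<partial>lborel)"
proof -
  let ?P = "Pi\<^sub>M {1..n} (\<lambda>_. borel :: real measure)" and ?Q = "Pi\<^sub>M {Suc n} (\<lambda>_. borel :: real measure)"
  let ?W = "\<lambda>\<omega>. restrict (\<lambda>i. U i \<omega>) {1..n}" and ?V = "\<lambda>\<omega>. restrict (\<lambda>i. U i \<omega>) {Suc n}"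
  \<comment> \<open>Reads sum and maximum off coordinate functions, since independence of blocks is
    available for the restricted families in product spaces.\<close>
  define \<Psi> where "\<Psi> = (\<lambda>(h, k). \<Phi> ((\<Sum>i=1..n. h i) + k (Suc n), max (Max ((\<lambda>i. h i) ` {1..n})) (k (Suc n :: nat))))"
  have [measurable]: "(\<lambda>h. \<Sum>i=1..n. h i) \<in> borel_measurable ?P"
      "(\<lambda>h. Max ((\<lambda>i. h i) ` {1..n})) \<in> borel_measurable ?P"
      "(\<lambda>k. k (Suc n)) \<in> borel_measurable ?Q"
    by (intro borel_measurable_sum borel_measurable_Max measurable_component_singleton; simp)+
  have [measurable]: "\<Psi> \<in> borel_measurable (?P \<Otimes>\<^sub>M ?Q)"
    unfolding \<Psi>_def by measurable
  have \<Psi>: "\<Psi> (?W \<omega>, ?V \<omega>') = \<Phi> (partial_sum U n \<omega> + U (Suc n) \<omega>',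
      max (partial_max U n \<omega>) (U (Suc n) \<omega>'))" for \<omega> \<omega>'
  proof -
    have "(\<lambda>i. ?W \<omega> i) ` {1..n} = (\<lambda>i. U i \<omega>) ` {1..n}"
      by (intro image_cong) auto
    then have "Max ((\<lambda>i. ?W \<omega> i) ` {1..n}) = partial_max U n \<omega>"
      by (simp only: partial_max_def)
    moreover have "(\<Sum>i=1..n. ?W \<omega> i) = partial_sum U n \<omega>"
      by (simp add: partial_sum_def)
    moreover have "?V \<omega>' (Suc n) = U (Suc n) \<omega>'" by simp
    ultimately show ?thesis
      unfolding \<Psi>_def prod.case by (simp only:)
  qed
  have [measurable]: "U (Suc n) \<in> borel_measurable M" by (rule U_measurable) simp
  have "indep_var ?P ?W ?Q ?V"
    by (rule indep_var_restrict[OF indep]) auto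
  then have [measurable]: "?W \<in> measurable M ?P" "?V \<in> measurable M ?Q"
    and joint: "distr M ?P ?W \<Otimes>\<^sub>M distr M ?Q ?V = distr M (?P \<Otimes>\<^sub>M ?Q) (\<lambda>\<omega>. (?W \<omega>, ?V \<omega>))"
    unfolding indep_var_distribution_eq by auto
  interpret W: prob_space "distr M ?P ?W" by (rule prob_space_distr) measurable
  interpret V: prob_space "distr M ?Q ?V" by (rule prob_space_distr) measurable
  interpret WV: pair_sigma_finite "distr M ?P ?W" "distr M ?Q ?V" ..
  have "(\<integral>\<^sup>+\<omega>. \<Phi> (partial_sum U (Suc n) \<omega>, partial_max U (Suc n) \<omega>) \<partial>M)
      = (\<integral>\<^sup>+\<omega>. \<Psi> (?W \<omega>, ?V \<omega>) \<partial>M)"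
    using n by (simp only: \<Psi> partial_sum_Suc partial_max_Suc)
  also have "\<dots> = integral\<^sup>N (distr M (?P \<Otimes>\<^sub>M ?Q) (\<lambda>\<omega>. (?W \<omega>, ?V \<omega>))) \<Psi>"
    by (rule nn_integral_distr[symmetric]) measurable
  also have "\<dots> = (\<integral>\<^sup>+k. \<integral>\<^sup>+h. \<Psi> (h, k) \<partial>distr M ?P ?W \<partial>distr M ?Q ?V)"
    unfolding joint[symmetric] by (rule WV.nn_integral_snd[symmetric]) measurable
  also have "\<dots> = (\<integral>\<^sup>+\<omega>'. \<integral>\<^sup>+h. \<Psi> (h, ?V \<omega>') \<partial>distr M ?P ?W \<partial>M)"
    by (rule nn_integral_distr) measurable
  also have "\<dots> = (\<integral>\<^sup>+\<omega>'. \<integral>\<^sup>+\<omega>. \<Psi> (?W \<omega>, ?V \<omega>') \<partial>M \<partial>M)"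
  proof (rule nn_integral_cong)
    fix \<omega>' assume "\<omega>' \<in> space M"
    then have [simp]: "?V \<omega>' \<in> space ?Q" by (rule measurable_space[rotated]) measurable
    show "(\<integral>\<^sup>+h. \<Psi> (h, ?V \<omega>') \<partial>distr M ?P ?W) = (\<integral>\<^sup>+\<omega>. \<Psi> (?W \<omega>, ?V \<omega>') \<partial>M)"
      by (rule nn_integral_distr) measurable
  qed
  also have "\<dots> = (\<integral>\<^sup>+x. ennreal (f (Suc n) x)
        * (\<integral>\<^sup>+\<omega>. \<Phi> (partial_sum U n \<omega> + x, max (partial_max U n \<omega>) x) \<partial>M) \<partial>lborel)"
    unfolding \<Psi> by (rule distributed_nn_integral[OF law, symmetric]) (simp, measurable)
  finally show ?thesis .
qed

text \<open>Stated for all test functions because the induction applies the hypothesis to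
  \<open>\<Phi>\<close> composed with \<open>(s + x, max w x)\<close>, for each fixed
  \<open>x\<close>.\<close>

lemma nn_integral_g_fun:
  assumes "n \<ge> 2" and "\<Phi> \<in> borel_measurable (borel \<Otimes>\<^sub>M borel)"
  shows "(\<integral>\<^sup>+\<omega>. \<Phi> (partial_sum U n \<omega>, partial_max U n \<omega>) \<partial>M)
    = (\<integral>\<^sup>+z. \<integral>\<^sup>+y. \<Phi> (y, z) * ennreal (reg_part (g_fun f n) y z) \<partial>lborel \<partial>lborel)"
  using assms
proof (induction n arbitrary: \<Phi> rule: nat_induct_at_least)
  case base
  note [measurable] = base
  have "(\<integral>\<^sup>+\<omega>. \<Phi> (partial_sum U 2 \<omega>, partial_max U 2 \<omega>) \<partial>M)
      = (\<integral>\<^sup>+x. ennreal (f 2 x) * (\<integral>\<^sup>+\<omega>. \<Phi> (U 1 \<omega> + x, max (U 1 \<omega>) x) \<partial>M) \<partial>lborel)"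
    using nn_integral_Suc[of 1 \<Phi>] base
    by (simp add: partial_sum_def partial_max_def numeral_2_eq_2)
  also have "\<dots> = (\<integral>\<^sup>+x. ennreal (f 2 x) * (\<integral>\<^sup>+a. ennreal (f 1 a) * \<Phi> (a + x, max a x) \<partial>lborel) \<partial>lborel)"
    by (intro nn_integral_cong arg_cong2[where f="(*)"] refl
        distributed_nn_integral[OF law, symmetric]) (simp, measurable)
  also have "\<dots> = (\<integral>\<^sup>+z. \<integral>\<^sup>+y. \<Phi> (y, z) * ennreal (reg_part (g_fun f 2) y z) \<partial>lborel \<partial>lborel)"
    by (rule nn_integral_g_fun_2[OF base])
  finally show ?case .
next
  case (Suc n)
  note [measurable] = Suc.prems
  have n: "n \<ge> 1" using Suc.hyps by simp
  note r = tame_g_fun[OF Suc.hyps(1)]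
  have "(\<integral>\<^sup>+\<omega>. \<Phi> (partial_sum U (Suc n) \<omega>, partial_max U (Suc n) \<omega>) \<partial>M)
    = (\<integral>\<^sup>+x. ennreal (f (Suc n) x)
        * (\<integral>\<^sup>+\<omega>. \<Phi> (partial_sum U n \<omega> + x, max (partial_max U n \<omega>) x) \<partial>M) \<partial>lborel)"
    by (rule nn_integral_Suc[OF n Suc.prems])
  also have "\<dots> = (\<integral>\<^sup>+x. ennreal (f (Suc n) x) * (\<integral>\<^sup>+w. \<integral>\<^sup>+s. \<Phi> (s + x, max w x)
        * ennreal (reg_part (g_fun f n) s w) \<partial>lborel \<partial>lborel) \<partial>lborel)"
  proof (intro nn_integral_cong arg_cong2[where f="(*)"] refl)
    fix x
    have "(\<lambda>p. \<Phi> (fst p + x, max (snd p) x)) \<in> borel_measurable (borel \<Otimes>\<^sub>M borel)"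
      by measurable
    from Suc.IH[OF this]
    show "(\<integral>\<^sup>+\<omega>. \<Phi> (partial_sum U n \<omega> + x, max (partial_max U n \<omega>) x) \<partial>M)
      = (\<integral>\<^sup>+w. \<integral>\<^sup>+s. \<Phi> (s + x, max w x) * ennreal (reg_part (g_fun f n) s w) \<partial>lborel \<partial>lborel)"
      by simp
  qed
  also have "\<dots> = (\<integral>\<^sup>+z. \<integral>\<^sup>+y. \<Phi> (y, z) * ennreal (reg_part (g_fun f (Suc n)) y z) \<partial>lborel \<partial>lborel)"
    unfolding reg_part_g_fun_Suc[OF Suc.hyps(1) r]
    by (rule nn_integral_step[OF density r Suc.prems]) simp
  finally show ?case .
qed

lemma ennreal_joint_cdf:
  "ennreal (joint_cdf M U n y z)
    = (\<integral>\<^sup>+\<omega>. indicator ({..y} \<times> {..z}) (partial_sum U n \<omega>, partial_max U n \<omega>) \<partial>M)"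
proof -
  let ?A = "{\<omega> \<in> space M. partial_sum U n \<omega> \<le> y \<and> partial_max U n \<omega> \<le> z}"
  have "ennreal (joint_cdf M U n y z) = (\<integral>\<^sup>+\<omega>. indicator ?A \<omega> \<partial>M)"
    by (subst nn_integral_indicator) (auto simp: joint_cdf_def emeasure_eq_measure)
  also have "\<dots> = (\<integral>\<^sup>+\<omega>. indicator ({..y} \<times> {..z}) (partial_sum U n \<omega>, partial_max U n \<omega>) \<partial>M)"
    by (intro nn_integral_cong) (auto simp: indicator_def)
  finally show ?thesis .
qed

lemma indicator_quadrant_measurable [measurable]:
  "indicator ({..y} \<times> {..z}) \<in> borel_measurable (borel \<Otimes>\<^sub>M borel)" for y z :: real
  by (intro borel_measurable_indicator pair_measureI) auto

lemma joint_cdf_eq_integral: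
  assumes "n \<ge> 2"
  shows "ennreal (joint_cdf M U n y z) =
    (\<integral>\<^sup>+w. (\<integral>\<^sup>+s. ennreal (reg_part (g_fun f n) s w) * indicator {..y} s \<partial>lborel) * indicator {..z} w \<partial>lborel)"
  unfolding ennreal_joint_cdf
  by (subst nn_integral_g_fun[OF assms indicator_quadrant_measurable])
     (rule nn_integral_indicator_times)

lemma joint_cdf_nonneg: "0 \<le> joint_cdf M U n y z"
  by (simp add: joint_cdf_def)

lemma joint_cdf_has_mixed_partial:
  assumes "n \<ge> 2" "y \<noteq> z" "y \<noteq> real n * z"
  shows "has_mixed_partial (joint_cdf M U n) (reg_part (g_fun f n) y z) y z"
  by (rule tame_has_mixed_partial[OF tame_g_fun[OF assms(1)] assms(2,3)
        joint_cdf_nonneg joint_cdf_eq_integral[OF assms(1)]])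

text \<open>\<open>nn_integral_Suc\<close> for the indicator of a quadrant is the recursion of
  \<open>G_fun\<close>.\<close>

lemma joint_cdf_eq_G_fun: "n \<ge> 1 \<Longrightarrow> joint_cdf M U n y z = G_fun f n y z"
proof (induction n arbitrary: y z rule: nat_induct_at_least)
  case base
  interpret f1: nonneg_density "f 1" by (rule density) simp
  obtain B where B: "\<forall>x\<le>min y z. f 1 x \<le> B" using f1.locally_bounded by blast
  note F = set_integral_nonneg_bounded[OF f1.measurable, of 0 "min y z" B]
  have bound: "0 \<le> f 1 x \<and> f 1 x \<le> B" if "x \<in> {0..min y z}" for x
    using B that f1.nonneg by auto
  have "ennreal (joint_cdf M U 1 y z) = (\<integral>\<^sup>+\<omega>. indicator {..min y z} (U 1 \<omega>) \<partial>M)"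
    unfolding ennreal_joint_cdf
    by (intro nn_integral_cong) (auto simp: partial_sum_def partial_max_def indicator_def)
  also have "\<dots> = (\<integral>\<^sup>+x. ennreal (f 1 x) * indicator {..min y z} x \<partial>lborel)"
    by (rule distributed_nn_integral[OF law, symmetric]) auto
  also have "\<dots> = (\<integral>\<^sup>+x\<in>{0..min y z}. ennreal (f 1 x) \<partial>lborel)"
    by (intro nn_integral_cong) (auto simp: indicator_def f1.neg simp del: One_nat_def)
  also have "\<dots> = ennreal (F_fun f 1 (min y z))"
    using bound by (simp only: F_fun_def F(2))
  finally have "joint_cdf M U 1 y z = F_fun f 1 (min y z)"
    using joint_cdf_nonneg F(3)[OF bound] by (simp add: ennreal_inj F_fun_def)
  moreover have "F_fun f 1 (min y z) = 0" if "y < 0 \<or> z < 0"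
    using that by (auto simp: F_fun_def set_lebesgue_integral_def)
  ultimately show ?case by auto
next
  case (Suc n)
  interpret \<phi>: nonneg_density "f (Suc n)" by (rule density) simp
  obtain m where m: "n = Suc m" using Suc.hyps by (cases n) auto
  obtain B where B: "\<forall>x\<le>min y z. f (Suc n) x \<le> B" "B \<ge> 0" using \<phi>.locally_bounded by blast
  have cdf_le_1: "joint_cdf M U n u z \<le> 1" for u by (simp add: joint_cdf_def)
  \<comment> \<open>A distribution function is monotone, hence measurable.\<close>
  have cdf_meas: "(\<lambda>u. joint_cdf M U n u z) \<in> borel_measurable borel"
    by (rule borel_measurable_mono) (auto simp: mono_def joint_cdf_def intro!: finite_measure_mono)
  have cdf_neg: "joint_cdf M U n u z = 0" if "u < 0" for u
    unfolding Suc.IH using that by (cases m) (auto simp: m)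
  have meas: "(\<lambda>x. joint_cdf M U n (y - x) z * f (Suc n) x) \<in> borel_measurable borel"
    using cdf_meas \<phi>.measurable by measurable
  have bound: "0 \<le> joint_cdf M U n (y - x) z * f (Suc n) x \<and> joint_cdf M U n (y - x) z * f (Suc n) x \<le> 1 * B"
    if "x \<in> {0..min y z}" for x
    using B that joint_cdf_nonneg \<phi>.nonneg cdf_le_1 by (auto intro!: mult_mono[of _ 1 _ B, simplified])
  note F = set_integral_nonneg_bounded[OF meas bound]
  have "ennreal (joint_cdf M U (Suc n) y z) = (\<integral>\<^sup>+x. ennreal (f (Suc n) x)
        * (\<integral>\<^sup>+\<omega>. indicator ({..y} \<times> {..z}) (partial_sum U n \<omega> + x, max (partial_max U n \<omega>) x) \<partial>M) \<partial>lborel)"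
    unfolding ennreal_joint_cdf by (rule nn_integral_Suc[OF Suc.hyps(1)]) measurable
  also have "\<dots> = (\<integral>\<^sup>+x\<in>{0..min y z}. ennreal (joint_cdf M U n (y - x) z * f (Suc n) x) \<partial>lborel)"
  proof (rule nn_integral_cong)
    fix x
    \<comment> \<open>The event forces \<open>x \<le> z\<close>. The remaining limits come from
      vanishing factors: \<open>f (Suc n)\<close> for \<open>x < 0\<close>, and the distribution
      function at \<open>y - x\<close> for \<open>x > y\<close>.\<close>
    have "(\<integral>\<^sup>+\<omega>. indicator ({..y} \<times> {..z}) (partial_sum U n \<omega> + x, max (partial_max U n \<omega>) x) \<partial>M)
        = (\<integral>\<^sup>+\<omega>. indicator ({..y - x} \<times> {..z}) (partial_sum U n \<omega>, partial_max U n \<omega>)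
             * indicator {..z} x \<partial>M)"
      by (intro nn_integral_cong) (auto simp: indicator_def)
    also have "\<dots> = ennreal (joint_cdf M U n (y - x) z) * indicator {..z} x"
      unfolding ennreal_joint_cdf by (rule nn_integral_multc) measurable
    finally show "ennreal (f (Suc n) x)
        * (\<integral>\<^sup>+\<omega>. indicator ({..y} \<times> {..z}) (partial_sum U n \<omega> + x, max (partial_max U n \<omega>) x) \<partial>M)
      = ennreal (joint_cdf M U n (y - x) z * f (Suc n) x) * indicator {0..min y z} x"
      using cdf_neg[of "y - x"] \<phi>.neg[of x] joint_cdf_nonneg \<phi>.nonneg
      by (auto simp: indicator_def ennreal_mult mult.commute)
  qed
  also have "\<dots> = ennreal (LINT x:{0..min y z}|lborel. joint_cdf M U n (y - x) z * f (Suc n) x)"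
    by (rule F(2)[symmetric])
  finally have "joint_cdf M U (Suc n) y z
      = (LINT x:{0..min y z}|lborel. joint_cdf M U n (y - x) z * f (Suc n) x)"
    by (subst (asm) ennreal_inj) (auto intro: joint_cdf_nonneg F(3))
  moreover have "(LINT x:{0..min y z}|lborel. joint_cdf M U n (y - x) z * f (Suc n) x) = 0" if "y < 0 \<or> z < 0"
    using that by (auto simp: set_lebesgue_integral_def)
  ultimately show ?case by (auto simp: m Suc.IH[unfolded m])
qed

text \<open>Transfers the law from the shifted variables back to the original ones, and from an
  iterated integral to the product measure.\<close>

lemma nn_integral_g_fun_translate:
  assumes n: "n \<ge> 2" and [measurable]: "\<Phi> \<in> borel_measurable (borel \<Otimes>\<^sub>M borel)"
  shows "(\<integral>\<^sup>+\<omega>. \<Phi> (partial_sum U n \<omega> - a, partial_max U n \<omega> - b) \<partial>M)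
    = (\<integral>\<^sup>+p. \<Phi> p * ennreal (reg_part (g_fun f n) (fst p + a) (snd p + b)) \<partial>(lborel \<Otimes>\<^sub>M lborel))"
proof -
  define q where "q p = ennreal (case p of (y, z) \<Rightarrow> reg_part (g_fun f n) y z)" for p
  have [measurable]: "q \<in> borel_measurable (borel \<Otimes>\<^sub>M borel)"
    unfolding q_def using tameD(1)[OF tame_g_fun[OF n]] by measurable
  have "(\<lambda>p. \<Phi> (fst p - a, snd p - b)) \<in> borel_measurable (borel \<Otimes>\<^sub>M borel)"
    by measurable
  from nn_integral_g_fun[OF n this]
  have "(\<integral>\<^sup>+\<omega>. \<Phi> (partial_sum U n \<omega> - a, partial_max U n \<omega> - b) \<partial>M)
      = (\<integral>\<^sup>+z. \<integral>\<^sup>+y. \<Phi> (y - a, z - b) * q (y, z) \<partial>lborel \<partial>lborel)"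
    by (simp add: q_def)
  also have "\<dots> = (\<integral>\<^sup>+z. \<integral>\<^sup>+y. \<Phi> (y, z - b) * q (y + a, z) \<partial>lborel \<partial>lborel)"
  proof (rule nn_integral_cong)
    fix z
    have "(\<lambda>y. \<Phi> (y - a, z - b) * q (y, z)) \<in> borel_measurable borel" by measurable
    from nn_integral_lborel_translate[OF this, of a]
    show "(\<integral>\<^sup>+y. \<Phi> (y - a, z - b) * q (y, z) \<partial>lborel) = (\<integral>\<^sup>+y. \<Phi> (y, z - b) * q (y + a, z) \<partial>lborel)"
      by simp
  qed
  also have "\<dots> = (\<integral>\<^sup>+z. \<integral>\<^sup>+y. \<Phi> (y, z) * q (y + a, z + b) \<partial>lborel \<partial>lborel)"
  proof -
    have "(\<lambda>z. \<integral>\<^sup>+y. \<Phi> (y, z - b) * q (y + a, z) \<partial>lborel) \<in> borel_measurable borel" by measurable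
    from nn_integral_lborel_translate[OF this, of b] show ?thesis by simp
  qed
  also have "\<dots> = (\<integral>\<^sup>+p. \<Phi> p * q (fst p + a, snd p + b) \<partial>(lborel \<Otimes>\<^sub>M lborel))"
    by (subst lborel_pair.nn_integral_snd[symmetric]) simp_all
  finally show ?thesis by (simp add: q_def)
qed

end

section \<open>Undoing the shift; the delta case \<open>n = 1\<close> and the ordinary case
  \<open>n \<ge> 2\<close>\<close>

theorem mainTheorem6:
  fixes M :: "'a measure" and c :: real
    and X :: "nat \<Rightarrow> 'a \<Rightarrow> real" and f' :: "nat \<Rightarrow> real \<Rightarrow> real" and n :: nat
  assumes "prob_space M"
    and "c > 0"
    and "prob_space.indep_vars M (\<lambda>_. borel) X {1..}"
    and "\<And>i. i \<ge> 1 \<Longrightarrow> AE \<omega> in M. - c \<le> X i \<omega>"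
    and "\<And>i. i \<ge> 1 \<Longrightarrow> distributed M lborel (X i) (\<lambda>x. ennreal (f' i x))"
    and "\<And>i x. i \<ge> 1 \<Longrightarrow> 0 \<le> f' i x"
    and "\<And>i. i \<ge> 1 \<Longrightarrow> continuous_on {- c..} (f' i)"
    and "\<And>i x. i \<ge> 1 \<Longrightarrow> x < - c \<Longrightarrow> f' i x = 0"
    and "n \<ge> 1"
  shows "(\<forall>y z. joint_cdf M X n y z = G_fun (shifted_pdf c f') n (y + real n * c) (z + c))
    \<and> generalized_joint_pdf M (partial_sum X n) (partial_max X n)
        (gen_shift (real n * c) c (g_fun (shifted_pdf c f') n))
    \<and> (n \<ge> 2 \<longrightarrow>
         distributed M (lborel \<Otimes>\<^sub>M lborel)
           (\<lambda>\<omega>. (partial_sum X n \<omega>, partial_max X n \<omega>))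
           (\<lambda>(y, z). ennreal (reg_part (g_fun (shifted_pdf c f') n) (y + real n * c) (z + c)))
         \<and> (AE (y, z) in lborel \<Otimes>\<^sub>M lborel.
              has_mixed_partial (joint_cdf M X n)
                (reg_part (g_fun (shifted_pdf c f') n) (y + real n * c) (z + c)) y z))"
proof -
  define U where "U i \<omega> = X i \<omega> + c" for i \<omega>
  define f where "f = shifted_pdf c f'"
  interpret prob_space M by fact
  interpret nonneg_indep_seq M f U
  proof (intro nonneg_indep_seq.intro nonneg_densities.intro nonneg_indep_seq_axioms.intro)
    show "prob_space M" by fact
  next
    fix i :: nat assume i: "i \<ge> 1"
    show "nonneg_density (f i)"
    proof
      show "continuous_on {0..} (f i)"
        unfolding f_def shifted_pdf_def
        by (rule continuous_on_compose2[OF assms(7)[OF i]]) (auto intro!: continuous_intros)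
    qed (use assms(6,8) i in \<open>auto simp: f_def shifted_pdf_def\<close>)
    show "distributed M lborel (U i) (\<lambda>x. ennreal (f i x))"
      using distributed_affine[OF assms(5)[OF i], of 1 c]
      by (simp add: U_def[abs_def] f_def shifted_pdf_def add.commute divide_ennreal_def)
  next
    show "indep_vars (\<lambda>_. borel) U {1..}"
      unfolding U_def[abs_def] by (rule indep_vars_compose2[OF assms(3)]) simp
  qed
  have sum_U: "partial_sum U n \<omega> = partial_sum X n \<omega> + real n * c" for \<omega>
    by (simp add: partial_sum_def U_def sum.distrib)
  have max_U: "partial_max U n \<omega> = partial_max X n \<omega> + c" for \<omega>
    unfolding partial_max_def U_def using \<open>n \<ge> 1\<close> by (intro Max_add_commute) auto
  have X_eq: "partial_sum X n = (\<lambda>\<omega>. partial_sum U n \<omega> - real n * c)"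
      "partial_max X n = (\<lambda>\<omega>. partial_max U n \<omega> - c)"
    by (simp_all add: sum_U max_U)
  have X_meas [measurable]: "partial_sum X n \<in> borel_measurable M" "partial_max X n \<in> borel_measurable M"
    unfolding X_eq by measurable
  have cdf_eq: "joint_cdf M X n = (\<lambda>y z. joint_cdf M U n (y + real n * c) (z + c))"
    by (simp add: joint_cdf_def sum_U max_U fun_eq_iff)
  have cdf: "joint_cdf M X n y z = G_fun f n (y + real n * c) (z + c)" for y z
    using joint_cdf_eq_G_fun[OF \<open>n \<ge> 1\<close>] by (simp add: cdf_eq)
  show ?thesis
  proof (cases "n = 1")
    case True
    have f'_meas [measurable]: "f' 1 \<in> borel_measurable borel"
    proof -
      have [measurable]: "f 1 \<in> borel_measurable borel"
        by (rule nonneg_density.measurable[OF density]) simp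
      have "(\<lambda>x. f 1 (x + c)) \<in> borel_measurable borel" by measurable
      then show ?thesis by (simp add: f_def shifted_pdf_def)
    qed
    \<comment> \<open>For \<open>n = 1\<close> sum and maximum are shifted by the same amount
      \<open>c\<close>, so the delta factor stays on the diagonal.\<close>
    have g1: "reg_part (gen_shift (real n * c) c (g_fun f n)) = (\<lambda>y z. 0)"
      "delta_offset (gen_shift (real n * c) c (g_fun f n)) = 0"
      by (simp_all add: True gen_shift_def)
    \<comment> \<open>\<open>D_set 1\<close> is the diagonal with nonnegative coordinates. After the
      shift the sign condition reads \<open>z \<ge> - c\<close>, and for smaller \<open>z\<close>
      the value \<open>f' 1 z\<close> is 0 anyway.\<close>
    have coeff: "delta_coeff (gen_shift (real n * c) c (g_fun f n)) = (\<lambda>y z. if y = z then f' 1 z else 0)"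
      using assms(8)[of 1] by (auto simp: True gen_shift_def D_set_def f_def shifted_pdf_def fun_eq_iff)
    have "quadrant_integral (gen_shift (real n * c) c (g_fun f n)) y z
        = ennreal (measure M {\<omega> \<in> space M. partial_sum X n \<omega> \<le> y \<and> partial_max X n \<omega> \<le> z})" for y z
    proof -
      let ?A = "{\<omega> \<in> space M. partial_sum X n \<omega> \<le> y \<and> partial_max X n \<omega> \<le> z}"
      \<comment> \<open>The mass over \<open>v\<close> sits at \<open>u = v\<close> and counts if
        \<open>v \<le> y\<close>, so the two cutoffs merge into \<open>min y z\<close>.\<close>
      have "quadrant_integral (gen_shift (real n * c) c (g_fun f n)) y z
          = (\<integral>\<^sup>+x. ennreal (f' 1 x) * indicator {..min y z} x \<partial>lborel)"
        unfolding quadrant_integral_def g1 coeff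
        by (auto simp: delta_integral_def indicator_def intro!: nn_integral_cong)
      also have "\<dots> = (\<integral>\<^sup>+\<omega>. indicator {..min y z} (X 1 \<omega>) \<partial>M)"
        by (rule distributed_nn_integral[OF assms(5)]) auto
      also have "\<dots> = (\<integral>\<^sup>+\<omega>. indicator ?A \<omega> \<partial>M)"
        by (intro nn_integral_cong) (auto simp: True indicator_def partial_sum_def partial_max_def)
      also have "\<dots> = ennreal (measure M ?A)"
        by (subst nn_integral_indicator) (auto simp: emeasure_eq_measure)
      finally show ?thesis .
    qed
    then have "generalized_joint_pdf M (partial_sum X n) (partial_max X n)
        (gen_shift (real n * c) c (g_fun f n))"
      unfolding generalized_joint_pdf_def g1 coeff using assms(6)[of 1] by auto
    then show ?thesis using cdf True unfolding f_def by simp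
  next
    case False
    with \<open>n \<ge> 1\<close> have n: "n \<ge> 2" by simp
    define r where "r p = reg_part (g_fun f n) (fst p + real n * c) (snd p + c)" for p
    have [measurable]: "r \<in> borel_measurable (borel \<Otimes>\<^sub>M borel)"
      unfolding r_def[abs_def] by (rule tame_measurable[OF tame_g_fun[OF n]]) measurable
    have law_X: "(\<integral>\<^sup>+\<omega>. \<Phi> (partial_sum X n \<omega>, partial_max X n \<omega>) \<partial>M)
        = (\<integral>\<^sup>+p. \<Phi> p * ennreal (r p) \<partial>(lborel \<Otimes>\<^sub>M lborel))"
      if "\<Phi> \<in> borel_measurable (borel \<Otimes>\<^sub>M borel)" for \<Phi>
      unfolding X_eq r_def by (rule nn_integral_g_fun_translate[OF n that])
    have "quadrant_integral (gen_shift (real n * c) c (g_fun f n)) y z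
        = ennreal (measure M {\<omega> \<in> space M. partial_sum X n \<omega> \<le> y \<and> partial_max X n \<omega> \<le> z})" for y z
    proof -
      let ?A = "{\<omega> \<in> space M. partial_sum X n \<omega> \<le> y \<and> partial_max X n \<omega> \<le> z}"
      have "quadrant_integral (gen_shift (real n * c) c (g_fun f n)) y z
          = (\<integral>\<^sup>+p. indicator ({..y} \<times> {..z}) p * ennreal (r p) \<partial>(lborel \<Otimes>\<^sub>M lborel))"
        by (simp add: quadrant_integral_def gen_shift_def delta_coeff_g_fun[OF n]
            delta_integral_def r_def mult.commute)
      also have "\<dots> = (\<integral>\<^sup>+\<omega>. indicator ({..y} \<times> {..z}) (partial_sum X n \<omega>, partial_max X n \<omega>) \<partial>M)"
        by (rule law_X[OF indicator_quadrant_measurable, symmetric])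
      also have "\<dots> = (\<integral>\<^sup>+\<omega>. indicator ?A \<omega> \<partial>M)"
        by (intro nn_integral_cong) (auto simp: indicator_def)
      also have "\<dots> = ennreal (measure M ?A)"
        by (subst nn_integral_indicator) (auto simp: emeasure_eq_measure)
      finally show ?thesis .
    qed
    then have pdf: "generalized_joint_pdf M (partial_sum X n) (partial_max X n)
        (gen_shift (real n * c) c (g_fun f n))"
      using tameD(2)[OF tame_g_fun[OF n]] \<open>r \<in> _\<close>
      by (simp add: generalized_joint_pdf_def gen_shift_def delta_coeff_g_fun[OF n]
          r_def[abs_def] case_prod_unfold)
    have dist: "distributed M (lborel \<Otimes>\<^sub>M lborel) (\<lambda>\<omega>. (partial_sum X n \<omega>, partial_max X n \<omega>))
        (\<lambda>p. ennreal (r p))"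
    proof (rule distributedI_nn_integral)
      fix A :: "(real \<times> real) set" assume "A \<in> sets (lborel \<Otimes>\<^sub>M lborel)"
      then have "A \<in> sets (borel \<Otimes>\<^sub>M borel)"
        by (simp cong: sets_pair_measure_cong)
      then show "(\<integral>\<^sup>+\<omega>. indicator A (partial_sum X n \<omega>, partial_max X n \<omega>) \<partial>M)
          = (\<integral>\<^sup>+p. indicator A p * ennreal (r p) \<partial>(lborel \<Otimes>\<^sub>M lborel))"
        by (intro law_X) simp
    qed measurable
    have "AE p in lborel \<Otimes>\<^sub>M lborel. fst p + real n * c \<noteq> snd p + c
        \<and> fst p + real n * c \<noteq> real n * (snd p + c)"
    proof (rule lborel_pair.AE_pair_measure)
      have "AE z in lborel. y + real n * c \<noteq> z + c \<and> y + real n * c \<noteq> real n * (z + c)" for y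
      proof -
        \<comment> \<open>These are the solutions in \<open>z\<close> of the two shifted line
          equations for fixed \<open>y\<close>; in the second the terms \<open>real n * c\<close>
          cancel.\<close>
        have "AE z in lborel. z \<noteq> y + real n * c - c \<and> z \<noteq> y / real n"
          by (intro AE_conjI AE_lborel_singleton)
        then show ?thesis
          by eventually_elim (use n in \<open>auto simp: field_simps\<close>)
      qed
      then show "AE y in lborel. AE z in lborel. fst (y, z) + real n * c \<noteq> snd (y, z) + c
        \<and> fst (y, z) + real n * c \<noteq> real n * (snd (y, z) + c)" by simp
    qed measurable
    then have "AE p in lborel \<Otimes>\<^sub>M lborel. has_mixed_partial (joint_cdf M X n) (r p) (fst p) (snd p)"
      unfolding cdf_eq r_def
      by eventually_elim (intro has_mixed_partial_shift joint_cdf_has_mixed_partial n; simp)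
    with cdf pdf dist show ?thesis
      by (simp add: f_def r_def case_prod_unfold)
  qed
qed

end
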